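(* Assume (A1). For all $\epsilon>0$ small enough there exist constants $C<\infty$, $\kappa>0$ and $\tilde c>0$ such that for all $x\in\mathbb{Z}^2$ with $\|x\|_\infty\ge 2$, \[ \mathbb{P}\bigl(\mathcal{R}(0,x)\ge \tilde c\log\|x\|_\infty\bigr)\ge 1-\frac{C}{\|x\|_\infty^{\kappa}}. \]
   Context: Coupling constants $J_{x,y}=J_{x-y}$ with $J_x=J_{-x}\ge0$ and $\sum_{x\in\mathbb{Z}^2}J_x=1$. (A1): there exist $\alpha>4$ and $J\ge0$ such that $J_x\le J\|x\|_1^{-\alpha}$ for all $x\ne0$. Random resistor network on $\mathbb{Z}^2$: independently for each unordered pair $\{x,y\}$ of distinct vertices with $J_{x,y}>0$, the edge is "shorted" (resistance $0$) with probability $\epsilon J_{x,y}$, and otherwise has resistance $1/J_{x,y}$ (conductance $J_{x,y}$); $\mathbb{P}$ denotes the law of this random choice. The effective resistance is $\mathcal{R}(0,x)=\mathcal{E}_{\rm eff}^{-1}$, where $\mathcal{E}_{\rm eff}=\inf\{\tfrac12\sum_{u,v}J_{u,v}(g(u)-g(v))^2\}$, the sum running over ordered pairs $(u,v)$ of distinct vertices such that $\{u,v\}$ is not shorted, and the infimum over functions $g:\mathbb{Z}^2\to\mathbb{R}$ with $g(0)=1$, $g(x)=0$ and $g(u)=g(v)$ for every shorted edge $\{u,v\}$ (with $\inf\emptyset=+\infty$, i.e. $\mathcal{R}(0,x)=0$ if $0$ and $x$ are joined by a chain of shorted edges). *)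

theory Defs
  imports "HOL-Probability.Probability"
begin

type_synonym site = "int \<times> int"

text \<open>Strict lexicographic order on sites, used only to pick a canonical orientation.\<close>
definition lexless :: "site \<Rightarrow> site \<Rightarrow> bool" where
  "lexless u v = (fst u < fst v \<or> (fst u = fst v \<and> snd u < snd v))"

definition zdiff :: "site \<Rightarrow> site \<Rightarrow> site" where
  "zdiff u v = (fst u - fst v, snd u - snd v)"

definition norm1 :: "site \<Rightarrow> real" where
  "norm1 x = real_of_int (\<bar>fst x\<bar> + \<bar>snd x\<bar>)"

definition norminf :: "site \<Rightarrow> real" where
  "norminf x = real_of_int (max \<bar>fst x\<bar> \<bar>snd x\<bar>)"

text \<open>Unordered pairs {u,v} with J_{u,v} > 0, represented canonically as (u,v) with lexless u v
  in the lexicographic order.\<close>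
definition edges :: "(site \<Rightarrow> real) \<Rightarrow> (site \<times> site) set" where
  "edges J = {(u, v). lexless u v \<and> J (zdiff u v) > 0}"

definition canon :: "site \<Rightarrow> site \<Rightarrow> site \<times> site" where
  "canon u v = (if lexless u v then (u, v) else (v, u))"

definition network :: "(site \<Rightarrow> real) \<Rightarrow> real \<Rightarrow> (site \<times> site \<Rightarrow> bool) measure" where
  "network J eps = (\<Pi>\<^sub>M e\<in>edges J. measure_pmf (bernoulli_pmf (eps * J (zdiff (fst e) (snd e)))))"

definition shorted :: "(site \<Rightarrow> real) \<Rightarrow> (site \<times> site \<Rightarrow> bool) \<Rightarrow> site \<Rightarrow> site \<Rightarrow> bool" where
  "shorted J \<omega> u v = (u \<noteq> v \<and> canon u v \<in> edges J \<and> \<omega> (canon u v))"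

definition energy :: "(site \<Rightarrow> real) \<Rightarrow> (site \<times> site \<Rightarrow> bool) \<Rightarrow> (site \<Rightarrow> real) \<Rightarrow> ennreal" where
  "energy J \<omega> g = ennreal (1/2) *
     (\<Sum>\<^sub>\<infinity> p \<in> {(u, v). u \<noteq> v \<and> \<not> shorted J \<omega> u v}.
        ennreal (J (zdiff (fst p) (snd p)) * (g (fst p) - g (snd p))\<^sup>2))"

definition eff_energy :: "(site \<Rightarrow> real) \<Rightarrow> (site \<times> site \<Rightarrow> bool) \<Rightarrow> site \<Rightarrow> ennreal" where
  "eff_energy J \<omega> x = (INF g \<in> {g. g (0, 0) = 1 \<and> g x = 0 \<and>
       (\<forall>u v. shorted J \<omega> u v \<longrightarrow> g u = g v)}. energy J \<omega> g)"

text \<open>Effective resistance R(0,x) = 1 / E_eff (in [0,\<infinity>]; 1/0 = \<infinity>, 1/\<infinity> = 0).\<close>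
definition eff_resistance :: "(site \<Rightarrow> real) \<Rightarrow> (site \<times> site \<Rightarrow> bool) \<Rightarrow> site \<Rightarrow> ennreal" where
  "eff_resistance J \<omega> x = inverse (eff_energy J \<omega> x)"

end

theory Submission
  imports Defs
begin

text \<open>
  Weight a site by \<open>w x = (1 + |x|) powr s\<close> with \<open>s = \<alpha> / 2 > 2\<close>. The sum of \<open>J x * w x\<close> is
  finite and \<open>w\<close> is submultiplicative, so for small \<open>\<epsilon>\<close> the shorted edges form a subcritical
  percolation whose connection probabilities satisfy \<open>\<Sum>v. P(u \<leftrightarrow> v) * w (v - u) \<le> 2\<close>.

  At scale \<open>16 ^ k\<close> let \<open>h\<^sub>k\<close> rise from 0 to 1 across an annulus, flattened by taking minima over
  the clusters inside the annulus. Since \<open>s > 2\<close>, with high probability no cluster near the annulus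
  is wide enough to leave it, and then \<open>h\<^sub>k\<close> is constant on shorted edges. By Markov's inequality
  \<open>h\<^sub>k\<close> has bounded energy with probability at least 15/16, and these events are independent for
  different \<open>k\<close>, so at least half of the scales \<open>m \<le> k < 2 m\<close> are good except with probability
  \<open>2 powr -m\<close>. Averaging \<open>1 - h\<^sub>k\<close> over the good scales gives a test function of energy \<open>O(1/m)\<close>,
  because different scales interact only through very long edges. Taking \<open>m\<close> of order
  \<open>log |x|\<close> gives the bound.
\<close>

section \<open>Independence of finitely determined events\<close>

text \<open>Cylinder events. They are predicates on all functions, not only on points of the product
  space, so that \<open>Q\<close> may also be evaluated at \<open>restrict \<omega> F\<close>, a
  point of the finite product over \<open>F\<close>.\<close>

definition determined_by :: "'i set \<Rightarrow> (('i \<Rightarrow> 'a) \<Rightarrow> bool) \<Rightarrow> bool" where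
  "determined_by F Q \<longleftrightarrow> (\<forall>\<omega> \<omega>'. (\<forall>i\<in>F. \<omega> i = \<omega>' i) \<longrightarrow> Q \<omega> = Q \<omega>')"

lemma determined_byD: "determined_by F Q \<Longrightarrow> (\<And>i. i \<in> F \<Longrightarrow> \<omega> i = \<omega>' i) \<Longrightarrow> Q \<omega> = Q \<omega>'"
  by (auto simp: determined_by_def)

lemma determined_by_restrict: "determined_by F Q \<Longrightarrow> Q (restrict \<omega> F) = Q \<omega>"
  by (rule determined_byD) auto

context
  fixes I :: "'i set" and p :: "'i \<Rightarrow> bool pmf" and M :: "('i \<Rightarrow> bool) measure"
  defines "M \<equiv> \<Pi>\<^sub>M i\<in>I. measure_pmf (p i)"
begin

interpretation PP: product_prob_space "\<lambda>i. measure_pmf (p i)" I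
  by (intro product_prob_spaceI measure_pmf.prob_space_axioms)

text \<open>A finite product of discrete two-point spaces is discrete, so measurability on it is
  automatic.\<close>

lemma sets_finite_bool_PiM:
  assumes "finite F"
  shows "sets (\<Pi>\<^sub>M i\<in>F. measure_pmf (p i)) = Pow (\<Pi>\<^sub>E i\<in>F. UNIV)"
proof -
  have "sets (\<Pi>\<^sub>M i\<in>F. measure_pmf (p i)) = sets (\<Pi>\<^sub>M i\<in>F. count_space (UNIV :: bool set))"
    by (intro sets_PiM_cong) auto
  also have "\<dots> = sets (count_space (\<Pi>\<^sub>E i\<in>F. UNIV))"
    using count_space_PiM_finite[OF assms, of "\<lambda>_. UNIV :: bool set"] by simp
  finally show ?thesis by simp
qed

lemma measurable_finite_bool_PiM:
  assumes "finite F" "determined_by F Q"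
  shows "Measurable.pred (\<Pi>\<^sub>M i\<in>F. measure_pmf (p i)) Q"
  unfolding pred_def by (auto simp: sets_finite_bool_PiM[OF assms(1)] space_PiM)

text \<open>\<open>Q\<close> factors through the measurable restriction map to the discrete finite
  product over \<open>F\<close>.\<close>

lemma measurable_determined_by:
  assumes F: "finite F" "F \<subseteq> I" and Q: "determined_by F Q"
  shows "{\<omega> \<in> space M. Q \<omega>} \<in> sets M"
proof -
  have "(\<lambda>\<omega>. restrict \<omega> F) \<in> measurable M (\<Pi>\<^sub>M i\<in>F. measure_pmf (p i))"
    unfolding M_def by (rule measurable_restrict_subset) fact
  then have "{\<omega> \<in> space M. Q (restrict \<omega> F)} \<in> sets M"
    using measurable_finite_bool_PiM[OF F(1) Q] by measurable
  then show ?thesis by (simp add: determined_by_restrict[OF Q])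
qed

lemma indep_vars_bool_PiM:
  "prob_space.indep_vars M (\<lambda>i. measure_pmf (p i)) (\<lambda>i \<omega>. \<omega> i) I"
proof (cases "I = {}")
  case True
  then show ?thesis
    unfolding M_def PP.P.indep_vars_def PP.P.indep_sets_def by auto
next
  case False
  have "distr M M (\<lambda>\<omega>. \<lambda>i\<in>I. \<omega> i) = distr M M (\<lambda>\<omega>. \<omega>)"
    by (intro distr_cong) (auto simp: M_def space_PiM)
  also have "\<dots> = M" by (simp add: distr_id2)
  also have "\<dots> = (\<Pi>\<^sub>M i\<in>I. distr M (measure_pmf (p i)) (\<lambda>\<omega>. \<omega> i))"
    unfolding M_def by (intro PiM_cong refl PP.PiM_component[symmetric])
  finally show ?thesis
    using False unfolding M_def
    by (subst PP.P.indep_vars_iff_distr_eq_PiM') auto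
qed

text \<open>The coordinates are independent, hence so are their restrictions to disjoint blocks, and
  \<open>Q k\<close> is a function of the block \<open>F k\<close>.\<close>

lemma prob_Ball_determined_by:
  assumes S: "finite S" and F: "\<And>k. k \<in> S \<Longrightarrow> finite (F k)" "\<And>k. k \<in> S \<Longrightarrow> F k \<subseteq> I"
    and disj: "disjoint_family_on F S" and Q: "\<And>k. k \<in> S \<Longrightarrow> determined_by (F k) (Q k)"
  shows "measure M {\<omega> \<in> space M. \<forall>k\<in>S. Q k \<omega>} = (\<Prod>k\<in>S. measure M {\<omega> \<in> space M. Q k \<omega>})"
proof (cases "S = {}")
  case True
  then show ?thesis using PP.P.prob_space by (simp add: M_def)
next
  case False
  let ?A = "\<lambda>k. {\<omega> \<in> space M. Q k (\<lambda>i\<in>F k. \<omega> i)}"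
  have eq: "?A k = {\<omega> \<in> space M. Q k \<omega>}" if "k \<in> S" for k
    using determined_by_restrict[OF Q[OF that]] by simp
  have "PP.P.indep_events ?A S"
    unfolding M_def
    using measurable_finite_bool_PiM[OF F(1) Q]
    by (intro PP.P.indep_eventsI_indep_vars[OF PP.P.indep_vars_restrict[OF indep_vars_bool_PiM[unfolded M_def] F(2) disj]])
       (auto simp: pred_def)
  then have "measure M (\<Inter>k\<in>S. ?A k) = (\<Prod>k\<in>S. measure M (?A k))"
    unfolding PP.P.indep_events_def M_def using S False by blast
  moreover have "(\<Inter>k\<in>S. ?A k) = {\<omega> \<in> space M. \<forall>k\<in>S. Q k \<omega>}"
    using False eq by auto
  ultimately show ?thesis using eq by simp
qed

end

section \<open>Geometry of the lattice\<close>

abbreviation sdist :: "site \<Rightarrow> site \<Rightarrow> real" where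
  "sdist u v \<equiv> norminf (zdiff u v)"

lemma norminf_nonneg [simp]: "0 \<le> norminf u"
  by (simp add: norminf_def)

lemma sdist_self [simp]: "sdist u u = 0"
  by (simp add: norminf_def zdiff_def)

lemma sdist_commute: "sdist u v = sdist v u"
  by (simp add: norminf_def zdiff_def abs_minus_commute)

lemma sdist_triangle: "sdist u w \<le> sdist u v + sdist v w"
  unfolding norminf_def zdiff_def of_int_add[symmetric] of_int_le_iff by auto

lemma norminf_le_add_sdist: "norminf u \<le> norminf v + sdist u v"
  unfolding norminf_def zdiff_def of_int_add[symmetric] of_int_le_iff by auto

lemma sdist_ge_one: "u \<noteq> v \<Longrightarrow> 1 \<le> sdist u v"
  unfolding norminf_def zdiff_def by (cases u; cases v) auto

definition sbox :: "nat \<Rightarrow> site set" where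
  "sbox n = {- int n..int n} \<times> {- int n..int n}"

lemma mem_box: "u \<in> sbox n \<longleftrightarrow> norminf u \<le> real n"
proof -
  have "norminf u \<le> real n \<longleftrightarrow> real_of_int (max \<bar>fst u\<bar> \<bar>snd u\<bar>) \<le> real_of_int (int n)"
    by (simp only: norminf_def of_int_of_nat_eq)
  also have "\<dots> \<longleftrightarrow> u \<in> sbox n"
    unfolding of_int_le_iff by (cases u) (auto simp: sbox_def)
  finally show ?thesis by simp
qed

lemma finite_box [simp]: "finite (sbox n)"
  by (simp add: sbox_def)

lemma card_box: "card (sbox n) = (2 * n + 1)\<^sup>2"
  proof -
  have "nat (2 * int n + 1) = 2 * n + 1" by simp
  then show ?thesis by (simp add: sbox_def card_cartesian_product power2_eq_square)
qed

lemma box_mono: "m \<le> n \<Longrightarrow> sbox m \<subseteq> sbox n"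
  by (auto simp: sbox_def)

lemma in_box_nat_ceiling: "u \<in> sbox (nat \<lceil>norminf u\<rceil>)"
  unfolding mem_box by (metis norminf_nonneg real_nat_ceiling_ge)

lemma finite_subset_box:
  assumes "finite Q" shows "\<exists>n. Q \<subseteq> sbox n"
proof -
  let ?n = "Max (insert 0 ((\<lambda>u. nat \<lceil>norminf u\<rceil>) ` Q))"
  have "u \<in> sbox ?n" if "u \<in> Q" for u
  proof -
    have "nat \<lceil>norminf u\<rceil> \<le> ?n" using assms that by (intro Max_ge) auto
    from box_mono[OF this] show ?thesis using in_box_nat_ceiling[of u] by blast
  qed
  then show ?thesis by blast
qed

section \<open>Clusters of shorted edges\<close>

lemma lexless_linear: "u \<noteq> v \<Longrightarrow> lexless u v \<or> lexless v u"
  by (cases u; cases v) (auto simp: lexless_def)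

lemma lexless_asym: "lexless u v \<Longrightarrow> \<not> lexless v u"
  by (auto simp: lexless_def)

lemma canon_commute: "u \<noteq> v \<Longrightarrow> canon u v = canon v u"
  using lexless_linear[of u v] lexless_asym[of u v] by (auto simp: canon_def)

lemma shorted_sym: "shorted J \<omega> u v \<Longrightarrow> shorted J \<omega> v u"
  by (auto simp: shorted_def canon_commute)

text \<open>Both ends of every step lie in \<open>R\<close>, so the relation depends only on edges
  inside \<open>R\<close>; by reflexivity a site outside \<open>R\<close> is its own singleton
  cluster.\<close>

definition conn :: "(site \<Rightarrow> real) \<Rightarrow> (site \<times> site \<Rightarrow> bool) \<Rightarrow> site set \<Rightarrow> site \<Rightarrow> site \<Rightarrow> bool" where
  "conn J \<omega> R = (\<lambda>a b. a \<in> R \<and> b \<in> R \<and> shorted J \<omega> a b)\<^sup>*\<^sup>*"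

lemma conn_refl [simp]: "conn J \<omega> R u u"
  by (simp add: conn_def)

lemma conn_trans: "conn J \<omega> R u v \<Longrightarrow> conn J \<omega> R v w \<Longrightarrow> conn J \<omega> R u w"
  unfolding conn_def by (rule rtranclp_trans)

lemma conn_shorted: "u \<in> R \<Longrightarrow> v \<in> R \<Longrightarrow> shorted J \<omega> u v \<Longrightarrow> conn J \<omega> R u v"
  unfolding conn_def by (rule r_into_rtranclp) simp

lemma conn_mono: "R \<subseteq> R' \<Longrightarrow> conn J \<omega> R u v \<Longrightarrow> conn J \<omega> R' u v"
  unfolding conn_def by (erule rtranclp_mono[THEN predicate2D, rotated]) auto

lemma conn_outside: "u \<notin> R \<Longrightarrow> conn J \<omega> R u v \<Longrightarrow> v = u"
  unfolding conn_def by (erule converse_rtranclpE) auto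

lemma conn_in: "u \<in> R \<Longrightarrow> conn J \<omega> R u v \<Longrightarrow> v \<in> R"
  unfolding conn_def by (erule rtranclp.cases) auto

lemma finite_cluster: "finite R \<Longrightarrow> finite {v. conn J \<omega> R u v}"
  by (rule finite_subset[of _ "insert u R"]) (use conn_in conn_outside in blast)+

text \<open>A path visits only finitely many sites; this is what lets bounds in boxes pass to the
  whole lattice.\<close>

lemma conn_finite_region:
  assumes "conn J \<omega> UNIV u v"
  shows "\<exists>n. conn J \<omega> (sbox n) u v"
  using assms unfolding conn_def[of _ _ UNIV]
proof (induction rule: rtranclp_induct)
  case base
  then show ?case by auto
next
  case (step v w)
  then obtain n where n: "conn J \<omega> (sbox n) u v" by blast
  obtain m where m: "{v, w} \<subseteq> sbox m" using finite_subset_box[of "{v, w}"] by auto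
  have "conn J \<omega> (sbox (max m n)) u v"
    by (rule conn_mono[OF box_mono n]) simp
  moreover have "conn J \<omega> (sbox (max m n)) v w"
    using m step.hyps(2) box_mono[of m "max m n"] by (intro conn_shorted) auto
  ultimately show ?case by (blast intro: conn_trans)
qed

text \<open>Cutting a path at its last visit to its starting point.\<close>

lemma conn_first_step:
  assumes "conn J \<omega> R u v" "v \<noteq> u"
  shows "\<exists>z\<in>R - {u}. shorted J \<omega> u z \<and> conn J \<omega> (R - {u}) z v"
proof -
  \<comment> \<open>Induction backwards from \<open>v\<close>, for an arbitrary start
    \<open>a\<close>: either the path found so far avoids \<open>u\<close>, or the tail after its
    last visit to \<open>u\<close> has been recorded.\<close>
  have "conn J \<omega> (R - {u}) a v \<or> (\<exists>z\<in>R - {u}. shorted J \<omega> u z \<and> conn J \<omega> (R - {u}) z v)"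
    if "conn J \<omega> R a v" for a
    using that unfolding conn_def[of _ _ R]
  proof (induction rule: converse_rtranclp_induct)
    case base
    then show ?case by simp
  next
    case (step a b)
    show ?case
    proof (cases "b = u")
      case True
      then show ?thesis using step.IH assms(2) conn_outside[of u "R - {u}" J \<omega> v] by auto
    next
      case False
      then show ?thesis
      proof (cases "a = u")
        case True
        then show ?thesis using step False by auto
      next
        case a: False
        then have "conn J \<omega> (R - {u}) a b"
          using step.hyps False by (intro conn_shorted) auto
        then show ?thesis using step.IH by (blast intro: conn_trans)
      qed
    qed
  qed
  from this[OF assms(1)] show ?thesis
    using assms(2) conn_outside[of u "R - {u}" J \<omega> v] by auto
qed

definition edges_in :: "(site \<Rightarrow> real) \<Rightarrow> site set \<Rightarrow> (site \<times> site) set" where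
  "edges_in J R = edges J \<inter> R \<times> R"

lemma finite_edges_in: "finite R \<Longrightarrow> finite (edges_in J R)"
  by (simp add: edges_in_def)

lemma edges_in_subset: "edges_in J R \<subseteq> edges J"
  by (simp add: edges_in_def)

lemma shorted_cong:
  assumes "\<And>e. e \<in> edges_in J R \<Longrightarrow> \<omega> e = \<omega>' e" "u \<in> R" "v \<in> R"
  shows "shorted J \<omega> u v = shorted J \<omega>' u v"
proof -
  have "canon u v \<in> R \<times> R" using assms(2,3) by (auto simp: canon_def)
  then show ?thesis using assms(1) by (auto simp: shorted_def edges_in_def)
qed

lemma conn_cong:
  assumes "\<And>e. e \<in> edges_in J R \<Longrightarrow> \<omega> e = \<omega>' e"
  shows "conn J \<omega> R = conn J \<omega>' R"
proof -
  have "(\<lambda>a b. a \<in> R \<and> b \<in> R \<and> shorted J \<omega> a b) = (\<lambda>a b. a \<in> R \<and> b \<in> R \<and> shorted J \<omega>' a b)"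
    using shorted_cong[of J R \<omega> \<omega>'] assms by (intro ext) blast
  then show ?thesis by (simp add: conn_def)
qed

lemma determined_by_conn: "determined_by (edges_in J R) (\<lambda>\<omega>. conn J \<omega> R u v)"
proof (unfold determined_by_def, intro allI impI)
  fix \<omega> \<omega>' :: "site \<times> site \<Rightarrow> bool" assume "\<forall>e\<in>edges_in J R. \<omega> e = \<omega>' e"
  then have "conn J \<omega> R = conn J \<omega>' R" by (intro conn_cong) auto
  then show "conn J \<omega> R u v = conn J \<omega>' R u v" by simp
qed

lemma conn_sym: "conn J \<omega> R u v \<Longrightarrow> conn J \<omega> R v u"
  unfolding conn_def
  by (rule sympD[OF symp_rtranclp]) (auto intro!: sympI shorted_sym)

section \<open>The subcritical network\<close>

text \<open>\<open>weight\<close> bounds finite partial sums, so the estimates can stay with finite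
  sums. \<open>2 * eps * W \<le> 1\<close> keeps the branching ratio \<open>eps * W\<close> at most
  1/2, and \<open>2 < s\<close> makes a tail of order \<open>l powr (- s)\<close> beat the number of
  sites, of order \<open>l ^ 2\<close>, in a box of side \<open>l\<close>.\<close>

locale subcritical_network =
  fixes J :: "site \<Rightarrow> real" and s W eps :: real
  assumes J_nonneg: "0 \<le> J x" and J_sym: "J (- fst x, - snd x) = J x" and s: "2 < s"
    and weight: "finite F \<Longrightarrow> (\<Sum>x\<in>F. J x * (1 + norminf x) powr s) \<le> W"
    and eps: "0 < eps" "2 * eps * W \<le> 1"
begin

lemma J_zdiff_commute: "J (zdiff u v) = J (zdiff v u)"
  using J_sym[of "zdiff u v"] by (simp add: zdiff_def)

lemma W_nonneg: "0 \<le> W"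
  using weight[of "{}"] by simp

lemma weight_zdiff:
  assumes "finite Q"
  shows "(\<Sum>v\<in>Q. J (zdiff u v) * (1 + sdist u v) powr s) \<le> W"
proof -
  have "inj_on (zdiff u) Q" by (auto simp: inj_on_def zdiff_def prod_eq_iff)
  then have "(\<Sum>v\<in>Q. J (zdiff u v) * (1 + sdist u v) powr s)
      = (\<Sum>x\<in>zdiff u ` Q. J x * (1 + norminf x) powr s)"
    by (simp add: sum.reindex)
  then show ?thesis using weight assms by simp
qed

text \<open>Common source of the bounds on total mass, second moment and tail of \<open>J\<close>:
  each integrand is dominated by a multiple of the weight.\<close>

lemma sum_J_dominated_le:
  assumes "finite Q" "0 \<le> c" "\<And>v. v \<in> Q \<Longrightarrow> f v \<le> c * (1 + sdist u v) powr s"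
  shows "(\<Sum>v\<in>Q. J (zdiff u v) * f v) \<le> c * W"
proof -
  have "(\<Sum>v\<in>Q. J (zdiff u v) * f v) \<le> (\<Sum>v\<in>Q. J (zdiff u v) * (c * (1 + sdist u v) powr s))"
    by (intro sum_mono mult_left_mono assms J_nonneg)
  also have "\<dots> = c * (\<Sum>v\<in>Q. J (zdiff u v) * (1 + sdist u v) powr s)"
    by (simp add: sum_distrib_left mult_ac)
  also have "\<dots> \<le> c * W" using weight_zdiff assms by (intro mult_left_mono) auto
  finally show ?thesis .
qed

lemma square_le_weight: "0 \<le> x \<Longrightarrow> x\<^sup>2 \<le> (1 + x) powr s"
proof -
  assume x: "0 \<le> x"
  then have "x\<^sup>2 \<le> (1 + x)\<^sup>2" by (intro power_mono) auto
  also have "\<dots> = (1 + x) powr 2" using x by (simp add: powr_numeral)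
  also have "\<dots> \<le> (1 + x) powr s" using x s by (intro powr_mono) auto
  finally show ?thesis .
qed

lemma one_le_weight: "1 \<le> (1 + sdist u v) powr s"
  using s by (intro ge_one_powr_ge_zero) auto

lemma sum_J_le: "finite Q \<Longrightarrow> (\<Sum>v\<in>Q. J (zdiff u v)) \<le> W"
  using sum_J_dominated_le[of Q 1 "\<lambda>_. 1" u] one_le_weight by simp

lemma sum_J_square_le: "finite Q \<Longrightarrow> (\<Sum>v\<in>Q. J (zdiff u v) * (sdist u v)\<^sup>2) \<le> W"
  using sum_J_dominated_le[of Q 1 "\<lambda>v. (sdist u v)\<^sup>2" u] square_le_weight by simp

lemma sum_J_far_le:
  assumes "finite Q" "0 < l"
  shows "(\<Sum>v\<in>Q. J (zdiff u v) * of_bool (l \<le> sdist u v)) \<le> W / l\<^sup>2"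
proof -
  have "of_bool (l \<le> sdist u v) \<le> 1 / l\<^sup>2 * (1 + sdist u v) powr s" for v
  proof -
    have "l\<^sup>2 \<le> (1 + sdist u v) powr s" if "l \<le> sdist u v"
      using order_trans[OF power_mono[OF that, of 2] square_le_weight] assms(2) by simp
    then show ?thesis using assms(2) by (simp add: field_simps)
  qed
  from sum_J_dominated_le[OF assms(1) _ this] show ?thesis by simp
qed

lemma J_le_W: "J x \<le> W"
proof -
  have "J x * 1 \<le> J x * (1 + norminf x) powr s"
    using s J_nonneg by (intro mult_left_mono ge_one_powr_ge_zero) auto
  then show ?thesis using weight[of "{x}"] by simp
qed

text \<open>Makes \<open>eps * J x\<close> a genuine Bernoulli parameter;
  \<open>bernoulli_pmf\<close> clamps values outside the unit interval.\<close>

lemma eps_J: "eps * J x \<in> {0..1}"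
proof -
  have "eps * J x \<le> eps * W" by (rule mult_left_mono[OF J_le_W]) (use eps in simp)
  moreover have "0 \<le> eps * J x" using eps J_nonneg by simp
  moreover have "2 * (eps * W) \<le> 1" using eps by (simp add: mult.assoc)
  ultimately show ?thesis unfolding atLeastAtMost_iff by linarith
qed

section \<open>Connection probabilities in finite regions\<close>

abbreviation P :: "(site \<times> site \<Rightarrow> bool) measure" where "P \<equiv> network J eps"

sublocale prob_space P
  unfolding network_def by (intro prob_space_PiM measure_pmf.prob_space_axioms)

lemmas events_determined_by =
  measurable_determined_by[of _ "edges J" _ "\<lambda>e. bernoulli_pmf (eps * J (zdiff (fst e) (snd e)))",
    folded network_def]

lemmas prob_Ball_determined_by' =
  prob_Ball_determined_by[of _ _ "edges J" _ "\<lambda>e. bernoulli_pmf (eps * J (zdiff (fst e) (snd e)))",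
    folded network_def]

lemma conn_event: "finite R \<Longrightarrow> {\<omega> \<in> space P. conn J \<omega> R u v} \<in> events"
  by (rule events_determined_by[OF finite_edges_in edges_in_subset determined_by_conn])

text \<open>The two-point function of the percolation of shorted edges inside
  \<open>R\<close>.\<close>

definition \<tau> :: "site set \<Rightarrow> site \<Rightarrow> site \<Rightarrow> real" where
  "\<tau> R u v = prob {\<omega> \<in> space P. conn J \<omega> R u v}"

lemma determined_by_shorted: "determined_by ({canon u z} \<inter> edges J) (\<lambda>\<omega>. shorted J \<omega> u z)"
  by (auto simp: determined_by_def shorted_def)

lemma prob_shorted_le: "prob {\<omega> \<in> space P. shorted J \<omega> u z} \<le> eps * J (zdiff u z)"
proof (cases "u \<noteq> z \<and> canon u z \<in> edges J")
  case False
  then have "\<not> shorted J \<omega> u z" for \<omega> by (auto simp: shorted_def)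
  then show ?thesis using eps_J[of "zdiff u z"] by simp
next
  case True
  interpret PP: product_prob_space "\<lambda>e. measure_pmf (bernoulli_pmf (eps * J (zdiff (fst e) (snd e))))" "edges J"
    by (intro product_prob_spaceI measure_pmf.prob_space_axioms)
  let ?e = "canon u z"
  have "{\<omega> \<in> space P. shorted J \<omega> u z} = {\<omega> \<in> space P. \<omega> ?e \<in> {True}}"
    using True by (auto simp: shorted_def)
  then have "emeasure P {\<omega> \<in> space P. shorted J \<omega> u z}
     = emeasure (measure_pmf (bernoulli_pmf (eps * J (zdiff (fst ?e) (snd ?e))))) {True}"
    using PP.emeasure_PiM_Collect_single[of ?e "{True}"] True by (simp add: network_def)
  also have "\<dots> = ennreal (eps * J (zdiff (fst ?e) (snd ?e)))"
    using eps_J by (simp add: emeasure_pmf_single)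
  also have "J (zdiff (fst ?e) (snd ?e)) = J (zdiff u z)"
    by (auto simp: canon_def intro: J_zdiff_commute)
  finally show ?thesis
    using eps_J[of "zdiff u z"] by (simp add: emeasure_eq_measure)
qed

text \<open>The edge from \<open>u\<close> to \<open>z\<close> does not lie inside
  \<open>R - {u}\<close>, so the two events depend on disjoint sets of edges and their probabilities
  multiply.\<close>

lemma prob_shorted_conn_le:
  assumes "finite R"
  shows "prob {\<omega> \<in> space P. shorted J \<omega> u z \<and> conn J \<omega> (R - {u}) z v}
    \<le> eps * J (zdiff u z) * \<tau> (R - {u}) z v"
proof -
  \<comment> \<open>The two events become a family indexed by 0 and 1, the form that the product
    rule expects.\<close>
  let ?F = "\<lambda>b::nat. if b = 0 then {canon u z} \<inter> edges J else edges_in J (R - {u})"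
  let ?Q = "\<lambda>(b::nat) \<omega>. if b = 0 then shorted J \<omega> u z else conn J \<omega> (R - {u}) z v"
  have "canon u z \<notin> edges_in J (R - {u})"
    by (auto simp: canon_def edges_in_def)
  then have "prob {\<omega> \<in> space P. \<forall>b\<in>{0, 1}. ?Q b \<omega>} = (\<Prod>b\<in>{0, 1}. prob {\<omega> \<in> space P. ?Q b \<omega>})"
    using finite_edges_in[of "R - {u}" J] assms determined_by_shorted[of u z]
      determined_by_conn[of J "R - {u}" z v]
    by (intro prob_Ball_determined_by'[of "{0, 1}" ?F ?Q])
       (auto simp: disjoint_family_on_def edges_in_subset[THEN subsetD])
  then have "prob {\<omega> \<in> space P. shorted J \<omega> u z \<and> conn J \<omega> (R - {u}) z v}
    = prob {\<omega> \<in> space P. shorted J \<omega> u z} * \<tau> (R - {u}) z v"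
    by (simp add: \<tau>_def)
  also have "\<dots> \<le> eps * J (zdiff u z) * \<tau> (R - {u}) z v"
    by (intro mult_right_mono prob_shorted_le) (simp add: \<tau>_def)
  finally show ?thesis .
qed

text \<open>Union bound over the site that follows the last visit to \<open>u\<close>. Because the
  rest of the path avoids \<open>u\<close>, plain independence does the work of a BK-type
  inequality.\<close>

lemma \<tau>_first_step:
  assumes "finite R" "v \<noteq> u"
  shows "\<tau> R u v \<le> (\<Sum>z\<in>R - {u}. eps * J (zdiff u z) * \<tau> (R - {u}) z v)"
proof -
  let ?A = "\<lambda>z. {\<omega> \<in> space P. shorted J \<omega> u z \<and> conn J \<omega> (R - {u}) z v}"
  have A: "?A z \<in> events" for z
  proof -
    have "{\<omega> \<in> space P. shorted J \<omega> u z} \<in> events"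
      by (rule events_determined_by[OF _ _ determined_by_shorted]) auto
    then show ?thesis
      using conn_event[of "R - {u}" z v] assms(1) by (simp add: sets.sets_Collect_conj)
  qed
  have "\<tau> R u v \<le> prob (\<Union>z\<in>R - {u}. ?A z)"
    unfolding \<tau>_def using A assms conn_first_step[of J _ R u v]
    by (intro finite_measure_mono) (auto intro!: sets.finite_UN)
  also have "\<dots> \<le> (\<Sum>z\<in>R - {u}. prob (?A z))"
    using A assms(1) by (intro finite_measure_subadditive_finite) auto
  also have "\<dots> \<le> (\<Sum>z\<in>R - {u}. eps * J (zdiff u z) * \<tau> (R - {u}) z v)"
    by (intro sum_mono prob_shorted_conn_le assms(1))
  finally show ?thesis .
qed

lemma \<tau>_bounds: "0 \<le> \<tau> R u v" "\<tau> R u v \<le> 1"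
  by (auto simp: \<tau>_def)

text \<open>The weight is submultiplicative, so the first-step inequality iterates like a
  geometric series with ratio \<open>eps * W\<close>.\<close>

lemma weight_submult: "(1 + sdist u v) powr s \<le> (1 + sdist u z) powr s * (1 + sdist z v) powr s"
proof -
  have "1 + sdist u v \<le> (1 + sdist u z) * (1 + sdist z v)"
    unfolding distrib_left distrib_right
    using sdist_triangle[of u v z] mult_nonneg_nonneg[OF norminf_nonneg[of "zdiff u z"] norminf_nonneg[of "zdiff z v"]]
    by linarith
  then have "(1 + sdist u v) powr s \<le> ((1 + sdist u z) * (1 + sdist z v)) powr s"
    using s by (intro powr_mono2) (auto simp: add_nonneg_nonneg)
  then show ?thesis by (simp add: powr_mult)
qed

lemma sum_\<tau>_weight_le:
  assumes "finite R" "u \<in> R"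
  shows "(\<Sum>v\<in>R. \<tau> R u v * (1 + sdist u v) powr s) \<le> 2"
  using assms
\<comment> \<open>The first step removes \<open>u\<close> from the region, which drives the
  induction. The bound 2 reproduces itself: the terms \<open>v \<noteq> u\<close> give at most
  \<open>2 * eps * W \<le> 1\<close>, and the term \<open>v = u\<close> at most 1.\<close>
proof (induction "card R" arbitrary: R u rule: less_induct)
  case less
  let ?w = "\<lambda>u v. (1 + sdist u v) powr s" and ?R = "R - {u}"
  have IH: "(\<Sum>v\<in>?R. \<tau> ?R z v * ?w z v) \<le> 2" if "z \<in> ?R" for z
    using less.prems that card_Diff1_less[of R u] by (intro less.hyps) (auto simp del: card_Diff_insert)
  have "(\<Sum>v\<in>?R. \<tau> R u v * ?w u v)
      \<le> (\<Sum>v\<in>?R. (\<Sum>z\<in>?R. eps * J (zdiff u z) * \<tau> ?R z v) * ?w u v)"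
    using less.prems by (intro sum_mono mult_right_mono \<tau>_first_step) auto
  also have "\<dots> = (\<Sum>v\<in>?R. \<Sum>z\<in>?R. eps * J (zdiff u z) * \<tau> ?R z v * ?w u v)"
    by (simp add: sum_distrib_right)
  also have "\<dots> \<le> (\<Sum>v\<in>?R. \<Sum>z\<in>?R. eps * J (zdiff u z) * \<tau> ?R z v * (?w u z * ?w z v))"
    using eps J_nonneg \<tau>_bounds
    by (intro sum_mono mult_left_mono weight_submult mult_nonneg_nonneg) auto
  also have "\<dots> = (\<Sum>z\<in>?R. eps * J (zdiff u z) * ?w u z * (\<Sum>v\<in>?R. \<tau> ?R z v * ?w z v))"
    by (subst sum.swap) (simp add: sum_distrib_left mult_ac)
  also have "\<dots> \<le> (\<Sum>z\<in>?R. eps * J (zdiff u z) * ?w u z * 2)"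
    using eps J_nonneg by (intro sum_mono mult_left_mono IH mult_nonneg_nonneg) auto
  also have "\<dots> = 2 * eps * (\<Sum>z\<in>?R. J (zdiff u z) * ?w u z)"
    by (simp add: sum_distrib_left mult_ac)
  also have "\<dots> \<le> 2 * eps * W"
    using weight_zdiff[of ?R u] less.prems eps by (intro mult_left_mono) auto
  also have "\<dots> \<le> 1" by (rule eps)
  finally have "(\<Sum>v\<in>?R. \<tau> R u v * ?w u v) \<le> 1" .
  moreover have "(\<Sum>v\<in>R. \<tau> R u v * ?w u v) = \<tau> R u u * ?w u u + (\<Sum>v\<in>?R. \<tau> R u v * ?w u v)"
    using less.prems by (simp add: sum.remove)
  ultimately show ?case using \<tau>_bounds[of R u u] by simp
qed

text \<open>Markov's inequality for the weighted sum: every endpoint at distance at least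
  \<open>l\<close> carries weight at least \<open>l powr s\<close>.\<close>

lemma prob_far_conn_box_le:
  assumes "0 < l" "u \<in> sbox n"
  shows "prob {\<omega> \<in> space P. \<exists>v\<in>sbox n. conn J \<omega> (sbox n) u v \<and> l \<le> sdist u v} \<le> 2 / l powr s"
proof -
  let ?V = "{v \<in> sbox n. l \<le> sdist u v}"
  have "{\<omega> \<in> space P. \<exists>v\<in>sbox n. conn J \<omega> (sbox n) u v \<and> l \<le> sdist u v}
     = (\<Union>v\<in>?V. {\<omega> \<in> space P. conn J \<omega> (sbox n) u v})" by auto
  also have "prob \<dots> \<le> (\<Sum>v\<in>?V. \<tau> (sbox n) u v)"
    unfolding \<tau>_def by (intro finite_measure_subadditive_finite) (auto intro!: conn_event)
  finally have *: "prob {\<omega> \<in> space P. \<exists>v\<in>sbox n. conn J \<omega> (sbox n) u v \<and> l \<le> sdist u v}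
    \<le> (\<Sum>v\<in>?V. \<tau> (sbox n) u v)" .
  have "l powr s * (\<Sum>v\<in>?V. \<tau> (sbox n) u v) = (\<Sum>v\<in>?V. \<tau> (sbox n) u v * l powr s)"
    by (simp add: sum_distrib_left mult_ac)
  also have "\<dots> \<le> (\<Sum>v\<in>?V. \<tau> (sbox n) u v * (1 + sdist u v) powr s)"
    using assms s \<tau>_bounds by (intro sum_mono mult_left_mono powr_mono2) auto
  also have "\<dots> \<le> (\<Sum>v\<in>sbox n. \<tau> (sbox n) u v * (1 + sdist u v) powr s)"
    using \<tau>_bounds by (intro sum_mono2) auto
  also have "\<dots> \<le> 2" using assms by (intro sum_\<tau>_weight_le) auto
  finally have "(\<Sum>v\<in>?V. \<tau> (sbox n) u v) \<le> 2 / l powr s"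
    using assms(1) by (simp add: field_simps)
  with * show ?thesis by linarith
qed

section \<open>Clusters in the whole lattice\<close>

definition wide_cluster :: "real \<Rightarrow> site \<Rightarrow> (site \<times> site \<Rightarrow> bool) set" where
  "wide_cluster l u = {\<omega> \<in> space P. \<exists>v. conn J \<omega> UNIV u v \<and> l \<le> sdist u v}"

text \<open>The bound in boxes does not depend on the box, so it survives the increasing
  limit.\<close>

lemma wide_cluster:
  assumes "0 < l"
  shows "wide_cluster l u \<in> events" "prob (wide_cluster l u) \<le> 2 / l powr s"
proof -
  \<comment> \<open>Starting the sequence of boxes at \<open>n0\<close> puts \<open>u\<close> into
    all of them, which the bound in boxes requires.\<close>
  obtain n0 where n0: "u \<in> sbox n0" using in_box_nat_ceiling by blast
  let ?A = "\<lambda>n. {\<omega> \<in> space P. \<exists>v\<in>sbox n. conn J \<omega> (sbox n) u v \<and> l \<le> sdist u v}"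
  have A: "?A n \<in> events" for n
  proof -
    have "?A n = (\<Union>v\<in>{v \<in> sbox n. l \<le> sdist u v}. {\<omega> \<in> space P. conn J \<omega> (sbox n) u v})" by auto
    also have "\<dots> \<in> events" by (intro sets.finite_UN conn_event) auto
    finally show ?thesis .
  qed
  have mono: "incseq (\<lambda>n. ?A (n0 + n))"
  proof (rule incseq_SucI)
    fix n
    have sub: "sbox (n0 + n) \<subseteq> sbox (n0 + Suc n)" by (rule box_mono) simp
    show "?A (n0 + n) \<subseteq> ?A (n0 + Suc n)"
      using sub conn_mono[OF sub] by blast
  qed
  have eq: "wide_cluster l u = (\<Union>n. ?A (n0 + n))"
  proof (intro equalityI subsetI)
    fix \<omega> assume "\<omega> \<in> wide_cluster l u"
    then obtain v where v: "\<omega> \<in> space P" "conn J \<omega> UNIV u v" "l \<le> sdist u v"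
      by (auto simp: wide_cluster_def)
    then obtain n where "conn J \<omega> (sbox n) u v" using conn_finite_region by blast
    then have "conn J \<omega> (sbox (n0 + n)) u v"
      using conn_mono[OF box_mono[of n "n0 + n"]] by simp
    moreover have "v \<in> sbox (n0 + n)"
      using n0 box_mono[of n0 "n0 + n"] by (intro conn_in[OF _ calculation]) auto
    ultimately show "\<omega> \<in> (\<Union>n. ?A (n0 + n))" using v by blast
  next
    fix \<omega> assume "\<omega> \<in> (\<Union>n. ?A (n0 + n))"
    then show "\<omega> \<in> wide_cluster l u"
      by (auto simp: wide_cluster_def intro: conn_mono[OF subset_UNIV])
  qed
  show "wide_cluster l u \<in> events" unfolding eq using A by (intro sets.countable_UN) auto
  have "(\<lambda>n. prob (?A (n0 + n))) \<longlonglongrightarrow> prob (\<Union>n. ?A (n0 + n))"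
    by (rule finite_Lim_measure_incseq[OF _ mono]) (use A in auto)
  then show "prob (wide_cluster l u) \<le> 2 / l powr s"
    unfolding eq
  proof (rule LIMSEQ_le_const2, intro exI allI impI)
    fix n
    have "u \<in> sbox (n0 + n)" using n0 box_mono[of n0 "n0 + n"] by auto
    then show "prob (?A (n0 + n)) \<le> 2 / l powr s" by (rule prob_far_conn_box_le[OF assms])
  qed
qed

end

section \<open>Measurability of the effective energy\<close>

definition live :: "(site \<Rightarrow> real) \<Rightarrow> (site \<times> site \<Rightarrow> bool) \<Rightarrow> (site \<times> site) set" where
  "live J \<omega> = {(u, v). u \<noteq> v \<and> \<not> shorted J \<omega> u v}"

abbreviation edge_energy :: "(site \<Rightarrow> real) \<Rightarrow> (site \<Rightarrow> real) \<Rightarrow> site \<times> site \<Rightarrow> real" where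
  "edge_energy J g p \<equiv> J (zdiff (fst p) (snd p)) * (g (fst p) - g (snd p))\<^sup>2"

text \<open>Replaces an infinite sum in \<open>ennreal\<close> by real finite sums; the factor 2
  undoes the one half in \<open>energy\<close>.\<close>

lemma energy_le_iff:
  assumes J: "\<And>x. 0 \<le> J x" and t: "0 \<le> t"
  shows "energy J \<omega> g \<le> ennreal t \<longleftrightarrow>
    (\<forall>F. finite F \<longrightarrow> F \<subseteq> live J \<omega> \<longrightarrow> sum (edge_energy J g) F \<le> 2 * t)"
proof -
  let ?S = "infsum (\<lambda>p. ennreal (edge_energy J g p)) (live J \<omega>)"
  have half: "ennreal (1/2) * X \<le> ennreal t \<longleftrightarrow> X \<le> ennreal (2 * t)" for X
  proof (cases X rule: ennreal_cases)
    case (real r)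
    then have "ennreal (1/2) * X = ennreal (r / 2)" by (simp add: ennreal_mult'[symmetric] del: ennreal_half)
    then show ?thesis using t real by (simp add: field_simps)
  next
    case top
    then show ?thesis by (simp add: ennreal_mult_top top_unique)
  qed
  have "energy J \<omega> g \<le> ennreal t \<longleftrightarrow> ?S \<le> ennreal (2 * t)"
    unfolding energy_def half live_def by simp
  also have "\<dots> \<longleftrightarrow> (\<forall>F. finite F \<longrightarrow> F \<subseteq> live J \<omega> \<longrightarrow>
      (\<Sum>p\<in>F. ennreal (edge_energy J g p)) \<le> ennreal (2 * t))"
    by (subst nonneg_infsum_complete) (auto simp: SUP_le_iff)
  also have "\<dots> \<longleftrightarrow> (\<forall>F. finite F \<longrightarrow> F \<subseteq> live J \<omega> \<longrightarrow> sum (edge_energy J g) F \<le> 2 * t)"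
    using J t by (simp add: sum_ennreal)
  finally show ?thesis .
qed

text \<open>A finite-volume relaxation of being a test function of energy at most \<open>t\<close>:
  constraints and energy are checked only in a box. The slack vanishes as \<open>n\<close> grows and
  is there because the infimum need not be known to be attained; the range \<open>{0..1}\<close>
  supplies compactness.\<close>

definition box_admissible ::
    "(site \<Rightarrow> real) \<Rightarrow> site \<Rightarrow> real \<Rightarrow> nat \<Rightarrow> (site \<times> site \<Rightarrow> bool) \<Rightarrow> (site \<Rightarrow> real) \<Rightarrow> bool" where
  "box_admissible J x t n \<omega> g \<longleftrightarrow>
     (\<forall>u. g u \<in> {0..1}) \<and> g (0, 0) = 1 \<and> g x = 0 \<and>
     (\<forall>u\<in>sbox n. \<forall>v\<in>sbox n. shorted J \<omega> u v \<longrightarrow> g u = g v) \<and>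
     sum (edge_energy J g) (live J \<omega> \<inter> sbox n \<times> sbox n) \<le> 2 * (t + 1 / real (Suc n))"

lemma determined_by_box_admissible:
  "determined_by (edges_in J (sbox n)) (\<lambda>\<omega>. \<exists>g. box_admissible J x t n \<omega> g)"
proof (unfold determined_by_def, intro allI impI)
  fix \<omega> \<omega>' :: "site \<times> site \<Rightarrow> bool"
  assume "\<forall>e\<in>edges_in J (sbox n). \<omega> e = \<omega>' e"
  then have *: "shorted J \<omega> u v = shorted J \<omega>' u v" if "u \<in> sbox n" "v \<in> sbox n" for u v
    using that by (intro shorted_cong) auto
  then have "live J \<omega> \<inter> sbox n \<times> sbox n = live J \<omega>' \<inter> sbox n \<times> sbox n"
    unfolding live_def by blast
  then show "(\<exists>g. box_admissible J x t n \<omega> g) = (\<exists>g. box_admissible J x t n \<omega>' g)"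
    using * by (simp add: box_admissible_def)
qed

lemma square_diff_clamp_le:
  fixes a b :: real
  shows "(max 0 (min 1 a) - max 0 (min 1 b))\<^sup>2 \<le> (a - b)\<^sup>2"
proof -
  have "\<bar>max 0 (min 1 a) - max 0 (min 1 b)\<bar> \<le> \<bar>a - b\<bar>" by (auto simp: max_def min_def)
  then show ?thesis by (rule abs_le_square_iff[THEN iffD1])
qed

lemma eff_energy_le_imp_box_admissible:
  assumes J: "\<And>x. 0 \<le> J x" and t: "0 \<le> t" and le: "eff_energy J \<omega> x \<le> ennreal t"
  shows "\<exists>g. box_admissible J x t n \<omega> g"
proof -
  have "eff_energy J \<omega> x < ennreal (t + 1 / real (Suc n))"
    by (rule le_less_trans[OF le]) (use t in \<open>simp add: ennreal_less_iff\<close>)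
  then obtain g where g: "g (0, 0) = 1" "g x = 0" "\<forall>u v. shorted J \<omega> u v \<longrightarrow> g u = g v"
      and en: "energy J \<omega> g < ennreal (t + 1 / real (Suc n))"
    unfolding eff_energy_def INF_less_iff by blast
  \<comment> \<open>Truncation to the unit interval keeps the boundary values and the equalities on
    shorted edges, and does not raise the energy.\<close>
  define h where "h u = max 0 (min 1 (g u))" for u
  have "sum (edge_energy J h) (live J \<omega> \<inter> sbox n \<times> sbox n)
      \<le> sum (edge_energy J g) (live J \<omega> \<inter> sbox n \<times> sbox n)"
    unfolding h_def by (intro sum_mono mult_left_mono square_diff_clamp_le J)
  also have "\<dots> \<le> 2 * (t + 1 / real (Suc n))"
  proof -
    have "energy J \<omega> g \<le> ennreal (t + 1 / real (Suc n))" using en by simp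
    then show ?thesis
      using t by (subst (asm) energy_le_iff[OF J]) auto
  qed
  finally have "box_admissible J x t n \<omega> h"
    using g unfolding box_admissible_def h_def by auto
  then show ?thesis by blast
qed

text \<open>Tychonoff's theorem; over countably many sites, compactness also yields convergent
  subsequences.\<close>

lemma compact_unit_cube: "compact {g :: site \<Rightarrow> real. \<forall>u. g u \<in> {0..1}}"
proof -
  have "{g :: site \<Rightarrow> real. \<forall>u. g u \<in> {0..1}} = PiE UNIV (\<lambda>_. {0..1})" by auto
  moreover have "compactin (product_topology (\<lambda>_. euclidean) UNIV) (PiE UNIV (\<lambda>_::site. {0..1::real}))"
    by (subst compactin_PiE) auto
  ultimately show ?thesis by (simp add: euclidean_product_topology)
qed

text \<open>Compactness: a subsequence of the box test functions converges pointwise. Each equality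
  and each finite energy sum involves finitely many sites, so it is controlled from some index on
  and passes to the limit.\<close>

lemma box_admissible_imp_eff_energy_le:
  assumes J: "\<And>x. 0 \<le> J x" and t: "0 \<le> t" and ex: "\<And>n. \<exists>g. box_admissible J x t n \<omega> g"
  shows "eff_energy J \<omega> x \<le> ennreal t"
proof -
  obtain f where f: "\<And>n. box_admissible J x t n \<omega> (f n)" using ex by metis
  then have "\<forall>n. f n \<in> {g. \<forall>u. g u \<in> {0..1}}" by (simp add: box_admissible_def)
  then obtain g r where r: "strict_mono (r :: nat \<Rightarrow> nat)" and lim: "(f \<circ> r) \<longlonglongrightarrow> g"
    using compact_imp_seq_compact[OF compact_unit_cube] unfolding seq_compact_def by metis
  have pt: "(\<lambda>i. f (r i) u) \<longlonglongrightarrow> g u" for u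
    using continuous_on_tendsto_compose[OF continuous_on_product_coordinates[of u] lim] by simp
  have eqI: "g u = c" if "\<And>i. f (r i) u = c" for u c
    using LIMSEQ_unique[OF pt[of u]] that by simp
  have "g (0, 0) = 1" "g x = 0" using f by (auto simp: box_admissible_def intro!: eqI)
  moreover have "g u = g v" if "shorted J \<omega> u v" for u v
  proof -
    obtain N where N: "{u, v} \<subseteq> sbox N" using finite_subset_box[of "{u, v}"] by auto
    have "f (r i) u = f (r i) v" if "N \<le> i" for i
    proof -
      have "N \<le> r i" using seq_suble[OF r, of i] that by simp
      then have "{u, v} \<subseteq> sbox (r i)" using N box_mono by blast
      then show ?thesis using f[of "r i"] \<open>shorted J \<omega> u v\<close> by (auto simp: box_admissible_def)
    qed
    then have "\<forall>\<^sub>F i in sequentially. f (r i) u = f (r i) v"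
      by (auto simp: eventually_sequentially)
    then have "(\<lambda>i. f (r i) v) \<longlonglongrightarrow> g u" using pt[of u] by (simp add: tendsto_cong)
    then show ?thesis using LIMSEQ_unique pt by blast
  qed
  moreover have "energy J \<omega> g \<le> ennreal t"
    unfolding energy_le_iff[OF J t]
  proof (intro allI impI)
    fix F assume F: "finite F" "F \<subseteq> live J \<omega>"
    obtain N where N: "fst ` F \<union> snd ` F \<subseteq> sbox N"
      using finite_subset_box[of "fst ` F \<union> snd ` F"] F(1) by auto
    have le: "sum (edge_energy J (f (r i))) F \<le> 2 * (t + 1 / real (Suc i))" if "N \<le> i" for i
    proof -
      have ri: "i \<le> r i" using seq_suble[OF r] .
      then have "fst ` F \<union> snd ` F \<subseteq> sbox (r i)" using N box_mono[of N "r i"] that by auto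
      then have "F \<subseteq> live J \<omega> \<inter> sbox (r i) \<times> sbox (r i)" using F(2) by (auto simp: image_subset_iff mem_Times_iff)
      then have "sum (edge_energy J (f (r i))) F
          \<le> sum (edge_energy J (f (r i))) (live J \<omega> \<inter> sbox (r i) \<times> sbox (r i))"
        using J by (intro sum_mono2) auto
      also have "\<dots> \<le> 2 * (t + 1 / real (Suc (r i)))"
        using f[of "r i"] by (simp only: box_admissible_def)
      also have "\<dots> \<le> 2 * (t + 1 / real (Suc i))"
        using ri by (simp add: frac_le)
      finally show ?thesis .
    qed
    have "(\<lambda>i. sum (edge_energy J (f (r i))) F) \<longlonglongrightarrow> sum (edge_energy J g) F"
      by (intro tendsto_intros pt)
    moreover have "(\<lambda>i. 2 * (t + 1 / real (Suc i))) \<longlonglongrightarrow> 2 * (t + 0)"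
      by (intro tendsto_intros LIMSEQ_Suc[OF lim_1_over_n])
    ultimately show "sum (edge_energy J g) F \<le> 2 * t"
      using LIMSEQ_le le by fastforce
  qed
  ultimately show ?thesis
    unfolding eff_energy_def by (intro INF_lower2[of g]) auto
qed

lemma le_eff_resistance_iff:
  assumes "0 < a"
  shows "ennreal a \<le> eff_resistance J \<omega> x \<longleftrightarrow> eff_energy J \<omega> x \<le> ennreal (1 / a)"
proof -
  have "ennreal a \<le> inverse E \<longleftrightarrow> E \<le> ennreal (1 / a)" for E :: ennreal
  proof (cases E rule: ennreal_cases)
    case (real r)
    then show ?thesis using assms
      by (cases "r = 0") (auto simp: inverse_ennreal field_simps)
  next
    case top
    then show ?thesis using assms by (auto simp: not_le)
  qed
  then show ?thesis by (simp add: eff_resistance_def)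
qed

context subcritical_network
begin

text \<open>\<open>eff_energy\<close> is an infimum over uncountably many functions, so
  measurability is not immediate. The box criterion turns the event into a countable intersection of
  cylinder events; monotonicity of \<open>prob\<close> in the final estimate relies on this.\<close>

lemma eff_resistance_event:
  assumes "0 < a"
  shows "{\<omega> \<in> space P. ennreal a \<le> eff_resistance J \<omega> x} \<in> events"
proof -
  have "eff_energy J \<omega> x \<le> ennreal (1 / a) \<longleftrightarrow> (\<forall>n. \<exists>g. box_admissible J x (1 / a) n \<omega> g)" for \<omega>
    using eff_energy_le_imp_box_admissible[of J "1 / a" \<omega> x]
      box_admissible_imp_eff_energy_le[of J "1 / a" x \<omega>] J_nonneg assms by auto
  then have "{\<omega> \<in> space P. ennreal a \<le> eff_resistance J \<omega> x}
      = {\<omega> \<in> space P. \<forall>n. \<exists>g. box_admissible J x (1 / a) n \<omega> g}"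
    unfolding le_eff_resistance_iff[OF assms] by simp
  also have "\<dots> \<in> events"
    by (intro sets.sets_Collect_countable_All
        events_determined_by[OF finite_edges_in edges_in_subset determined_by_box_admissible]) simp
  finally show ?thesis .
qed

end

section \<open>The test function\<close>

text \<open>A radial ramp that climbs linearly from 0 at radius \<open>16 ^ k\<close> to 1 at radius
  \<open>2 * 16 ^ k\<close>.\<close>

definition \<psi> :: "nat \<Rightarrow> site \<Rightarrow> real" where
  "\<psi> k u = max 0 (min 1 (norminf u / 16 ^ k - 1))"

text \<open>Wider than the ramp of \<open>\<psi> k\<close> on both sides, which leaves room for the
  displacement of narrow clusters. The ratio 16 between scales keeps different annuli
  disjoint.\<close>

definition annulus :: "nat \<Rightarrow> site set" where
  "annulus k = {u. 16 ^ k / 2 < norminf u \<and> norminf u < 4 * 16 ^ k}"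

lemma \<psi>_bounds: "0 \<le> \<psi> k u" "\<psi> k u \<le> 1"
  by (auto simp: \<psi>_def)

lemma \<psi>_inner: "norminf u \<le> 16 ^ k \<Longrightarrow> \<psi> k u = 0"
proof -
  assume "norminf u \<le> 16 ^ k"
  then have "norminf u / 16 ^ k \<le> 1" by simp
  then show ?thesis unfolding \<psi>_def by linarith
qed

lemma \<psi>_outer: "2 * 16 ^ k \<le> norminf u \<Longrightarrow> \<psi> k u = 1"
  by (simp add: \<psi>_def field_simps)

lemma \<psi>_lipschitz: "\<bar>\<psi> k u - \<psi> k v\<bar> \<le> sdist u v / 16 ^ k"
proof -
  have "\<bar>\<psi> k u - \<psi> k v\<bar> \<le> \<bar>norminf u / 16 ^ k - norminf v / 16 ^ k\<bar>"
    unfolding \<psi>_def by linarith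
  also have "\<dots> = \<bar>norminf u - norminf v\<bar> / 16 ^ k"
    by (simp add: diff_divide_distrib[symmetric])
  also have "\<dots> \<le> sdist u v / 16 ^ k"
    using norminf_le_add_sdist[of u v] norminf_le_add_sdist[of v u] sdist_commute[of u v]
    by (intro divide_right_mono) auto
  finally show ?thesis .
qed

lemma annulus_subset: "annulus k \<subseteq> sbox (4 * 16 ^ k)"
  by (auto simp: annulus_def mem_box)

lemma finite_annulus [simp]: "finite (annulus k)"
  using annulus_subset finite_box by (rule finite_subset)

lemma card_box_pow16: "real (card (sbox (c * 16 ^ k))) \<le> (2 * real c + 1)\<^sup>2 * (16 ^ k)\<^sup>2"
proof -
  have "real (2 * (c * 16 ^ k) + 1) \<le> (2 * real c + 1) * 16 ^ k"
    by (simp add: algebra_simps)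
  then have "(real (2 * (c * 16 ^ k) + 1))\<^sup>2 \<le> ((2 * real c + 1) * 16 ^ k)\<^sup>2"
    by (rule power_mono) simp
  then show ?thesis by (simp add: card_box power_mult_distrib)
qed

lemma pow16_less: "j < k \<Longrightarrow> 16 * 16 ^ j \<le> (16 ^ k :: real)"
  using power_increasing[of "Suc j" k "16::real"] by simp

lemma annulus_disjoint: "j \<noteq> k \<Longrightarrow> annulus j \<inter> annulus k = {}"
proof (induction j k rule: linorder_wlog)
  case (le j k)
  then have "16 * 16 ^ j \<le> (16 ^ k :: real)" by (intro pow16_less) auto
  then show ?case by (auto simp: annulus_def)
qed auto

text \<open>The function \<open>h\<^sub>k\<close>. Only clusters inside the annulus enter, so
  profiles at different scales depend on disjoint sets of edges; off the annulus the cluster is a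
  singleton and the profile is \<open>\<psi> k\<close>.\<close>

definition profile :: "(site \<Rightarrow> real) \<Rightarrow> (site \<times> site \<Rightarrow> bool) \<Rightarrow> nat \<Rightarrow> site \<Rightarrow> real" where
  "profile J \<omega> k u = Min (\<psi> k ` {v. conn J \<omega> (annulus k) u v})"

lemma profile_attained: "\<exists>v. conn J \<omega> (annulus k) u v \<and> profile J \<omega> k u = \<psi> k v"
proof -
  have "profile J \<omega> k u \<in> \<psi> k ` {v. conn J \<omega> (annulus k) u v}"
    unfolding profile_def
    by (intro Min_in finite_imageI finite_cluster finite_annulus) (use conn_refl in blast)
  then show ?thesis by auto
qed

lemma profile_bounds: "0 \<le> profile J \<omega> k u" "profile J \<omega> k u \<le> 1"
  using profile_attained[of J \<omega> k u] \<psi>_bounds by metis+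

lemma profile_outside: "u \<notin> annulus k \<Longrightarrow> profile J \<omega> k u = \<psi> k u"
  using profile_attained[of J \<omega> k u] conn_outside[of u "annulus k" J \<omega>] by auto

lemma profile_inner: "norminf u \<le> 16 ^ k / 2 \<Longrightarrow> profile J \<omega> k u = 0"
  using zero_less_power[of "16::real" k]
  by (subst profile_outside) (auto simp: annulus_def simp del: zero_less_power intro!: \<psi>_inner)

lemma profile_outer: "4 * 16 ^ k \<le> norminf u \<Longrightarrow> profile J \<omega> k u = 1"
  using zero_less_power[of "16::real" k]
  by (subst profile_outside) (auto simp: annulus_def simp del: zero_less_power intro!: \<psi>_outer)

lemma profile_const:
  assumes "u \<in> annulus k" "v \<in> annulus k" "shorted J \<omega> u v"
  shows "profile J \<omega> k u = profile J \<omega> k v"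
proof -
  have "conn J \<omega> (annulus k) u v" using assms by (rule conn_shorted)
  then have "{w. conn J \<omega> (annulus k) u w} = {w. conn J \<omega> (annulus k) v w}"
    using conn_trans conn_sym by blast
  then show ?thesis by (simp add: profile_def)
qed

text \<open>Concerns clusters in the whole lattice, unlike \<open>profile\<close>, so it is not
  local to a scale; its failure is later handled by union bounds instead of independence.\<close>

definition narrow :: "(site \<Rightarrow> real) \<Rightarrow> (site \<times> site \<Rightarrow> bool) \<Rightarrow> nat \<Rightarrow> bool" where
  "narrow J \<omega> k \<longleftrightarrow> (\<forall>u\<in>sbox (4 * 16 ^ k). \<forall>v. conn J \<omega> UNIV u v \<longrightarrow> sdist u v < 16 ^ k / 4)"

lemma narrowD: "narrow J \<omega> k \<Longrightarrow> norminf u \<le> 4 * 16 ^ k \<Longrightarrow> conn J \<omega> R u v \<Longrightarrow> sdist u v < 16 ^ k / 4"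
proof -
  assume *: "narrow J \<omega> k" "norminf u \<le> 4 * 16 ^ k" "conn J \<omega> R u v"
  have "u \<in> sbox (4 * 16 ^ k)" using *(2) by (simp add: mem_box)
  then show ?thesis using * conn_mono[OF subset_UNIV *(3)] unfolding narrow_def by blast
qed

text \<open>By narrowness, neither the edge nor a cluster inside the annulus can carry a site from
  beyond a rim to the ramp, so both values are 0 at the inner rim and both are 1 at the outer
  rim.\<close>

lemma profile_shorted_outside:
  assumes nar: "narrow J \<omega> k" and sh: "shorted J \<omega> u v" and u: "u \<notin> annulus k"
  shows "profile J \<omega> k u = profile J \<omega> k v"
proof -
  obtain w where w: "conn J \<omega> (annulus k) v w" "profile J \<omega> k v = \<psi> k w"
    using profile_attained by blast
  have uv: "conn J \<omega> UNIV u v" "conn J \<omega> UNIV v u"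
    using sh by (auto intro: conn_shorted shorted_sym)
  have tri: "norminf v \<le> norminf u + sdist u v" "norminf u \<le> norminf v + sdist u v"
     "norminf w \<le> norminf v + sdist v w" "norminf v \<le> norminf w + sdist v w"
     using norminf_le_add_sdist sdist_commute by metis+
  have pos: "(0::real) < 16 ^ k" by simp
  consider "norminf u \<le> 16 ^ k / 2" | "4 * 16 ^ k \<le> norminf u" using u by (force simp: annulus_def)
  then show ?thesis
  proof cases
    case 1
    \<comment> \<open>In units of \<open>16 ^ k\<close> the budget is 1/2 + 1/4 + 1/4 = 1, exactly
      the radius where the ramp begins.\<close>
    have "sdist u v < 16 ^ k / 4" using narrowD[OF nar _ uv(1)] 1 pos by linarith
    then have "norminf v \<le> 4 * 16 ^ k" "norminf v \<le> 3 / 4 * 16 ^ k" using tri 1 pos by linarith+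
    then have "norminf w \<le> 16 ^ k" using narrowD[OF nar _ w(1)] tri by linarith
    then show ?thesis using w 1 by (simp add: profile_inner \<psi>_inner)
  next
    case 2
    show ?thesis
    proof (cases "4 * 16 ^ k \<le> norminf v")
      case True
      then show ?thesis using 2 by (simp add: profile_outer)
    next
      \<comment> \<open>Narrowness controls only starting sites of radius at most
        \<open>4 * 16 ^ k\<close>, so here it is applied at \<open>v\<close> and not at
        \<open>u\<close>.\<close>
      case False
      then have v: "norminf v \<le> 4 * 16 ^ k" by simp
      have "sdist u v < 16 ^ k / 4" using narrowD[OF nar v uv(2)] sdist_commute by metis
      moreover have "sdist v w < 16 ^ k / 4" using narrowD[OF nar v w(1)] .
      ultimately have "2 * 16 ^ k \<le> norminf w" using tri 2 pos by linarith
      then show ?thesis using w 2 by (simp add: profile_outer \<psi>_outer)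
    qed
  qed
qed

lemma profile_shorted:
  assumes "narrow J \<omega> k" "shorted J \<omega> u v"
  shows "profile J \<omega> k u = profile J \<omega> k v"
  using profile_const[OF _ _ assms(2)] profile_shorted_outside[OF assms]
    profile_shorted_outside[OF assms(1) shorted_sym[OF assms(2)]] by metis

text \<open>Total squared displacement within clusters; it measures the cost of flattening the
  ramp.\<close>

definition spread :: "(site \<Rightarrow> real) \<Rightarrow> (site \<times> site \<Rightarrow> bool) \<Rightarrow> nat \<Rightarrow> real" where
  "spread J \<omega> k = (\<Sum>u\<in>annulus k. \<Sum>v\<in>annulus k. of_bool (conn J \<omega> (annulus k) u v) * (sdist u v)\<^sup>2)"

text \<open>The minimum is attained at some site \<open>w\<close> of the cluster, and the Lipschitz
  bound applies to \<open>w\<close>. Summing over the whole cluster removes the dependence on the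
  unknown \<open>w\<close>.\<close>

lemma square_profile_diff_le:
  assumes "u \<in> annulus k"
  shows "(profile J \<omega> k u - \<psi> k u)\<^sup>2
    \<le> (\<Sum>v\<in>annulus k. of_bool (conn J \<omega> (annulus k) u v) * (sdist u v)\<^sup>2) / (16 ^ k)\<^sup>2"
proof -
  obtain w where w: "conn J \<omega> (annulus k) u w" "profile J \<omega> k u = \<psi> k w"
    using profile_attained by blast
  have "(profile J \<omega> k u - \<psi> k u)\<^sup>2 = \<bar>\<psi> k u - \<psi> k w\<bar>\<^sup>2"
    using w by (simp add: power2_commute)
  also have "\<dots> \<le> (sdist u w / 16 ^ k)\<^sup>2" by (intro power_mono \<psi>_lipschitz) auto
  also have "\<dots> = (of_bool (conn J \<omega> (annulus k) u w) * (sdist u w)\<^sup>2) / (16 ^ k)\<^sup>2"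
    using w by (simp add: power_divide)
  also have "\<dots> \<le> (\<Sum>v\<in>annulus k. of_bool (conn J \<omega> (annulus k) u v) * (sdist u v)\<^sup>2) / (16 ^ k)\<^sup>2"
    using conn_in[OF assms w(1)] by (intro divide_right_mono member_le_sum) auto
  finally show ?thesis .
qed

lemma sum_square_profile_diff_le:
  assumes "finite Q"
  shows "(\<Sum>u\<in>Q. (profile J \<omega> k u - \<psi> k u)\<^sup>2) \<le> spread J \<omega> k / (16 ^ k)\<^sup>2"
proof -
  have "(\<Sum>u\<in>Q. (profile J \<omega> k u - \<psi> k u)\<^sup>2) = (\<Sum>u\<in>Q \<inter> annulus k. (profile J \<omega> k u - \<psi> k u)\<^sup>2)"
    using assms by (intro sum.mono_neutral_right) (auto simp: profile_outside)
  also have "\<dots> \<le> (\<Sum>u\<in>annulus k. (profile J \<omega> k u - \<psi> k u)\<^sup>2)"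
    by (intro sum_mono2) auto
  also have "\<dots> \<le> (\<Sum>u\<in>annulus k.
      (\<Sum>v\<in>annulus k. of_bool (conn J \<omega> (annulus k) u v) * (sdist u v)\<^sup>2) / (16 ^ k)\<^sup>2)"
    by (intro sum_mono square_profile_diff_le)
  also have "\<dots> = spread J \<omega> k / (16 ^ k)\<^sup>2" by (simp add: spread_def sum_divide_distrib)
  finally show ?thesis .
qed

lemma square_sum_three_le: "(a + b + c)\<^sup>2 \<le> 3 * (a\<^sup>2 + b\<^sup>2 + c\<^sup>2)" for a b c :: real
proof -
  have "0 \<le> (a - b)\<^sup>2 + (b - c)\<^sup>2 + (a - c)\<^sup>2" by simp
  then show ?thesis by (simp add: power2_eq_square algebra_simps)
qed

text \<open>Cross terms are ordered by scale because the bound on them depends on which scale is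
  larger.\<close>

lemma square_sum_le:
  fixes d :: "nat \<Rightarrow> real"
  assumes "finite S"
  shows "(\<Sum>k\<in>S. d k)\<^sup>2 \<le> (\<Sum>k\<in>S. (d k)\<^sup>2) + 2 * (\<Sum>k\<in>S. \<Sum>j\<in>{j\<in>S. j < k}. \<bar>d j\<bar> * \<bar>d k\<bar>)"
  using assms
proof (induction rule: finite_linorder_max_induct)
  case empty
  then show ?case by simp
next
  case (insert b A)
  have b: "b \<notin> A" using insert.hyps(2) by blast
  have 1: "{j \<in> insert b A. j < b} = A" using insert.hyps(2) by auto
  have 2: "{j \<in> insert b A. j < k} = {j \<in> A. j < k}" if "k \<in> A" for k
    using insert.hyps(2) that by force
  have "(\<Sum>k\<in>insert b A. d k)\<^sup>2 = (d b)\<^sup>2 + (\<Sum>k\<in>A. d k)\<^sup>2 + 2 * (d b * (\<Sum>k\<in>A. d k))"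
    using insert.hyps(1) b by (simp add: power2_sum)
  moreover have "d b * (\<Sum>k\<in>A. d k) \<le> (\<Sum>j\<in>A. \<bar>d j\<bar> * \<bar>d b\<bar>)"
  proof -
    have "d b * (\<Sum>k\<in>A. d k) \<le> \<bar>d b\<bar> * \<bar>\<Sum>k\<in>A. d k\<bar>" by (metis abs_ge_self abs_mult)
    also have "\<dots> \<le> \<bar>d b\<bar> * (\<Sum>k\<in>A. \<bar>d k\<bar>)" by (intro mult_left_mono sum_abs) auto
    finally show ?thesis by (simp add: sum_distrib_left mult.commute)
  qed
  moreover have "(\<Sum>k\<in>A. \<Sum>j | j \<in> insert b A \<and> j < k. \<bar>d j\<bar> * \<bar>d k\<bar>) = (\<Sum>k\<in>A. \<Sum>j | j \<in> A \<and> j < k. \<bar>d j\<bar> * \<bar>d k\<bar>)"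
    using 2 by (intro sum.cong) auto
  ultimately show ?case using insert.IH insert.hyps(1) b 1 by simp
qed

lemma sum_geometric_le:
  assumes "finite S"
  shows "(\<Sum>j\<in>{j\<in>S. j < k}. (16 ^ j)\<^sup>2 / (16 ^ k)\<^sup>2) \<le> (1::real)"
proof -
  have "(\<Sum>j\<in>{j\<in>S. j < k}. (16 ^ j)\<^sup>2 :: real) \<le> (\<Sum>j<k. (16 ^ j)\<^sup>2)"
    by (intro sum_mono2) auto
  also have "\<dots> = (\<Sum>j<k. 256 ^ j)" by (simp add: power2_eq_square power_mult_distrib[symmetric])
  also have "\<dots> \<le> 256 ^ k"
  proof (induction k)
    case (Suc k)
    then show ?case using zero_le_power[of "256::real" k] unfolding sum.lessThan_Suc power_Suc by linarith
  qed simp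
  also have "\<dots> = (16 ^ k)\<^sup>2" by (simp add: power2_eq_square power_mult_distrib[symmetric])
  finally show ?thesis by (simp add: sum_divide_distrib[symmetric])
qed

section \<open>Energy of the profiles and of their average\<close>

context subcritical_network
begin

text \<open>Symmetry of \<open>J\<close> allows each pair to be charged to just one of its
  endpoints.\<close>

lemma sum_J_symmetrize_le:
  assumes "\<And>u v. F u v \<le> a u v + a v u"
  shows "(\<Sum>u\<in>Q. \<Sum>v\<in>Q. J (zdiff u v) * F u v) \<le> 2 * (\<Sum>u\<in>Q. \<Sum>v\<in>Q. J (zdiff u v) * a u v)"
proof -
  have "(\<Sum>u\<in>Q. \<Sum>v\<in>Q. J (zdiff u v) * F u v) \<le> (\<Sum>u\<in>Q. \<Sum>v\<in>Q. J (zdiff u v) * (a u v + a v u))"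
    by (intro sum_mono mult_left_mono assms J_nonneg)
  also have "\<dots> = (\<Sum>u\<in>Q. \<Sum>v\<in>Q. J (zdiff u v) * a u v) + (\<Sum>u\<in>Q. \<Sum>v\<in>Q. J (zdiff u v) * a v u)"
    by (simp add: distrib_left sum.distrib)
  also have "(\<Sum>u\<in>Q. \<Sum>v\<in>Q. J (zdiff u v) * a v u) = (\<Sum>u\<in>Q. \<Sum>v\<in>Q. J (zdiff u v) * a u v)"
    by (subst sum.swap) (simp add: J_zdiff_commute)
  finally show ?thesis by simp
qed

lemma sum_J_localized_le:
  assumes "finite Q" "finite B" "0 \<le> c" "\<And>u. (\<Sum>v\<in>Q. J (zdiff u v) * b u v) \<le> c"
  shows "(\<Sum>u\<in>Q. \<Sum>v\<in>Q. J (zdiff u v) * (of_bool (u \<in> B) * b u v)) \<le> real (card B) * c"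
proof -
  have "(\<Sum>u\<in>Q. \<Sum>v\<in>Q. J (zdiff u v) * (of_bool (u \<in> B) * b u v))
      = (\<Sum>u\<in>Q. of_bool (u \<in> B) * (\<Sum>v\<in>Q. J (zdiff u v) * b u v))"
    by (simp add: sum_distrib_left mult_ac)
  also have "\<dots> \<le> (\<Sum>u\<in>Q. of_bool (u \<in> B) * c)"
    by (intro sum_mono mult_left_mono assms) auto
  also have "\<dots> = real (card (Q \<inter> B)) * c"
    using assms(1) by (simp add: of_bool_def if_distrib[of "\<lambda>x. x * c"] sum.If_cases cong: if_cong)
  also have "\<dots> \<le> real (card B) * c"
    using assms by (intro mult_right_mono) (auto intro: card_mono)
  finally show ?thesis .
qed

text \<open>Scale invariance of the Dirichlet energy in dimension two: about
  \<open>(16 ^ k)\<^sup>2\<close> sites each contribute at most the second moment of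
  \<open>J\<close> divided by \<open>(16 ^ k)\<^sup>2\<close>. The constant is 2 * 25.\<close>

lemma energy_\<psi>_le:
  assumes "finite Q"
  shows "(\<Sum>u\<in>Q. \<Sum>v\<in>Q. J (zdiff u v) * (\<psi> k u - \<psi> k v)\<^sup>2) \<le> 50 * W"
proof -
  let ?B = "sbox (2 * 16 ^ k)"
  let ?a = "\<lambda>u v. of_bool (u \<in> ?B) * ((sdist u v)\<^sup>2 / (16 ^ k)\<^sup>2)"
  have a_nonneg: "0 \<le> ?a u v" for u v by simp
  have "(\<psi> k u - \<psi> k v)\<^sup>2 \<le> ?a u v + ?a v u" for u v
  proof (cases "u \<in> ?B \<or> v \<in> ?B")
    case True
    have "(\<psi> k u - \<psi> k v)\<^sup>2 = \<bar>\<psi> k u - \<psi> k v\<bar>\<^sup>2" by simp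
    also have "\<dots> \<le> (sdist u v / 16 ^ k)\<^sup>2" by (intro power_mono \<psi>_lipschitz) auto
    finally have "(\<psi> k u - \<psi> k v)\<^sup>2 \<le> (sdist u v)\<^sup>2 / (16 ^ k)\<^sup>2" by (simp add: power_divide)
    moreover have "(sdist u v)\<^sup>2 / (16 ^ k)\<^sup>2 \<le> ?a u v + ?a v u"
      using True sdist_commute[of u v] by auto
    ultimately show ?thesis by (rule order_trans)
  next
    case False
    then have "\<psi> k u = 1" "\<psi> k v = 1" by (auto simp: mem_box intro!: \<psi>_outer)
    then show ?thesis using False by simp
  qed
  then have "(\<Sum>u\<in>Q. \<Sum>v\<in>Q. J (zdiff u v) * (\<psi> k u - \<psi> k v)\<^sup>2)
      \<le> 2 * (\<Sum>u\<in>Q. \<Sum>v\<in>Q. J (zdiff u v) * ?a u v)"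
    by (rule sum_J_symmetrize_le)
  also have "(\<Sum>u\<in>Q. \<Sum>v\<in>Q. J (zdiff u v) * ?a u v) \<le> real (card ?B) * (W / (16 ^ k)\<^sup>2)"
  proof (rule sum_J_localized_le)
    fix u
    have "(\<Sum>v\<in>Q. J (zdiff u v) * ((sdist u v)\<^sup>2 / (16 ^ k)\<^sup>2))
        = (\<Sum>v\<in>Q. J (zdiff u v) * (sdist u v)\<^sup>2) / (16 ^ k)\<^sup>2"
      by (simp add: sum_divide_distrib)
    also have "\<dots> \<le> W / (16 ^ k)\<^sup>2"
      using assms by (intro divide_right_mono sum_J_square_le) auto
    finally show "(\<Sum>v\<in>Q. J (zdiff u v) * ((sdist u v)\<^sup>2 / (16 ^ k)\<^sup>2)) \<le> W / (16 ^ k)\<^sup>2" .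
  qed (use assms W_nonneg in auto)
  also have "real (card ?B) * (W / (16 ^ k)\<^sup>2) \<le> (25 * (16 ^ k)\<^sup>2) * (W / (16 ^ k)\<^sup>2)"
    using card_box_pow16[of 2 k] W_nonneg by (intro mult_right_mono) auto
  also have "\<dots> = 25 * W" by simp
  finally show ?thesis by simp
qed

lemma energy_profile_le:
  assumes "finite Q"
  shows "(\<Sum>u\<in>Q. \<Sum>v\<in>Q. J (zdiff u v) * (profile J \<omega> k u - profile J \<omega> k v)\<^sup>2)
    \<le> 6 * W * (spread J \<omega> k / (16 ^ k)\<^sup>2) + 150 * W"
proof -
  let ?e = "\<lambda>u. (profile J \<omega> k u - \<psi> k u)\<^sup>2"
  \<comment> \<open>The increment is the flattening error at \<open>u\<close>, minus that at
    \<open>v\<close>, plus the increment of \<open>\<psi> k\<close>; the last, being symmetric, is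
    shared equally between the endpoints.\<close>
  have "(profile J \<omega> k u - profile J \<omega> k v)\<^sup>2
      \<le> (3 * ?e u + 3/2 * (\<psi> k u - \<psi> k v)\<^sup>2) + (3 * ?e v + 3/2 * (\<psi> k v - \<psi> k u)\<^sup>2)" for u v
    using square_sum_three_le[of "profile J \<omega> k u - \<psi> k u" "\<psi> k v - profile J \<omega> k v" "\<psi> k u - \<psi> k v"]
    by (simp add: power2_commute[of "\<psi> k v"] algebra_simps)
  then have "(\<Sum>u\<in>Q. \<Sum>v\<in>Q. J (zdiff u v) * (profile J \<omega> k u - profile J \<omega> k v)\<^sup>2)
    \<le> 2 * (\<Sum>u\<in>Q. \<Sum>v\<in>Q. J (zdiff u v) * (3 * ?e u + 3/2 * (\<psi> k u - \<psi> k v)\<^sup>2))"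
    by (rule sum_J_symmetrize_le)
  also have "\<dots> = 6 * (\<Sum>u\<in>Q. ?e u * (\<Sum>v\<in>Q. J (zdiff u v)))
      + 3 * (\<Sum>u\<in>Q. \<Sum>v\<in>Q. J (zdiff u v) * (\<psi> k u - \<psi> k v)\<^sup>2)"
    by (simp add: distrib_left sum.distrib sum_distrib_left sum_distrib_right mult_ac)
  also have "\<dots> \<le> 6 * (\<Sum>u\<in>Q. ?e u * W) + 3 * (50 * W)"
    using assms by (intro add_mono mult_left_mono sum_mono sum_J_le energy_\<psi>_le) auto
  also have "(\<Sum>u\<in>Q. ?e u * W) = (\<Sum>u\<in>Q. ?e u) * W" by (simp add: sum_distrib_right)
  also have "\<dots> \<le> spread J \<omega> k / (16 ^ k)\<^sup>2 * W"
    using assms W_nonneg by (intro mult_right_mono sum_square_profile_diff_le)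
  finally show ?thesis by (simp add: mult_ac)
qed

text \<open>Profiles at different scales interact only through edges longer than a quarter of the
  larger scale.\<close>

lemma cross_energy_profile_le:
  assumes "finite Q" "j < k"
  shows "(\<Sum>u\<in>Q. \<Sum>v\<in>Q. J (zdiff u v) *
      (\<bar>profile J \<omega> j u - profile J \<omega> j v\<bar> * \<bar>profile J \<omega> k u - profile J \<omega> k v\<bar>))
    \<le> 2592 * W * (16 ^ j)\<^sup>2 / (16 ^ k)\<^sup>2"
proof -
  let ?B = "sbox (4 * 16 ^ j)"
  let ?d = "\<lambda>k u v. \<bar>profile J \<omega> k u - profile J \<omega> k v\<bar>"
  let ?a = "\<lambda>u v. of_bool (u \<in> ?B) * of_bool (16 ^ k / 4 \<le> sdist u v) :: real"
  have sc: "16 * 16 ^ j \<le> (16 ^ k :: real)" by (rule pow16_less) fact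
  \<comment> \<open>If both increments are nonzero, the inner endpoint has radius below
    \<open>4 * 16 ^ j\<close>, at most \<open>16 ^ k / 4\<close>, and the outer one radius above
    \<open>16 ^ k / 2\<close>.\<close>
  have key: "?d j u v * ?d k u v \<le> ?a u v" if uv: "norminf u \<le> norminf v" for u v
  proof (cases "?d j u v = 0 \<or> ?d k u v = 0")
    case True
    then show ?thesis by auto
  next
    case False
    have "\<not> 4 * 16 ^ j \<le> norminf u" using False uv profile_outer[of j u J \<omega>] profile_outer[of j v J \<omega>] by auto
    moreover have "\<not> norminf v \<le> 16 ^ k / 2" using False uv profile_inner[of u k J \<omega>] profile_inner[of v k J \<omega>] by auto
    ultimately have "?a u v = 1"
      using sc norminf_le_add_sdist[of v u] sdist_commute[of u v] by (auto simp: mem_box)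
    moreover have "?d j u v * ?d k u v \<le> 1 * 1"
    proof (intro mult_mono)
      show "?d i u v \<le> 1" for i
        using profile_bounds[of J \<omega> i u] profile_bounds[of J \<omega> i v] by linarith
      then show "?d k u v \<le> 1" .
    qed auto
    ultimately show ?thesis by simp
  qed
  have a_nonneg: "0 \<le> ?a u v" for u v by simp
  have "?d j u v * ?d k u v \<le> ?a u v + ?a v u" for u v
  proof (cases "norminf u \<le> norminf v")
    case True
    then show ?thesis using key[of u v] a_nonneg[of v u] by linarith
  next
    case False
    then have "?d j v u * ?d k v u \<le> ?a v u" by (intro key) simp
    then show ?thesis
      using a_nonneg[of u v] by (simp only: abs_minus_commute[of "profile J \<omega> _ v"])
  qed
  then have "(\<Sum>u\<in>Q. \<Sum>v\<in>Q. J (zdiff u v) * (?d j u v * ?d k u v))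
      \<le> 2 * (\<Sum>u\<in>Q. \<Sum>v\<in>Q. J (zdiff u v) * ?a u v)"
    by (rule sum_J_symmetrize_le)
  also have "(\<Sum>u\<in>Q. \<Sum>v\<in>Q. J (zdiff u v) * ?a u v) \<le> real (card ?B) * (W / (16 ^ k / 4)\<^sup>2)"
    using assms W_nonneg by (intro sum_J_localized_le sum_J_far_le) auto
  also have "\<dots> \<le> (81 * (16 ^ j)\<^sup>2) * (W / (16 ^ k / 4)\<^sup>2)"
    using card_box_pow16[of 4 j] W_nonneg by (intro mult_right_mono) auto
  also have "\<dots> = 1296 * W * (16 ^ j)\<^sup>2 / (16 ^ k)\<^sup>2" by (simp add: power_divide)
  finally show ?thesis by simp
qed

text \<open>Near-orthogonality: the cross terms with a fixed larger scale sum to a geometric series,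
  so the energy grows only linearly in the number of scales.\<close>

lemma energy_sum_profile_le:
  assumes Q: "finite Q" and S: "finite S" and L: "\<And>k. k \<in> S \<Longrightarrow> spread J \<omega> k \<le> L * (16 ^ k)\<^sup>2"
  shows "(\<Sum>u\<in>Q. \<Sum>v\<in>Q. J (zdiff u v) * (\<Sum>k\<in>S. profile J \<omega> k u - profile J \<omega> k v)\<^sup>2)
    \<le> real (card S) * (6 * W * L + 5334 * W)"
proof -
  let ?d = "\<lambda>k u v. profile J \<omega> k u - profile J \<omega> k v"
  let ?T = "\<lambda>f. \<Sum>u\<in>Q. \<Sum>v\<in>Q. J (zdiff u v) * f u v"
  have "?T (\<lambda>u v. (\<Sum>k\<in>S. ?d k u v)\<^sup>2)
     \<le> ?T (\<lambda>u v. (\<Sum>k\<in>S. (?d k u v)\<^sup>2) + 2 * (\<Sum>k\<in>S. \<Sum>j\<in>{j\<in>S. j < k}. \<bar>?d j u v\<bar> * \<bar>?d k u v\<bar>))"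
    by (intro sum_mono mult_left_mono square_sum_le S J_nonneg)
  also have "\<dots> = (\<Sum>k\<in>S. ?T (\<lambda>u v. (?d k u v)\<^sup>2))
      + 2 * (\<Sum>k\<in>S. \<Sum>j\<in>{j\<in>S. j < k}. ?T (\<lambda>u v. \<bar>?d j u v\<bar> * \<bar>?d k u v\<bar>))"
  proof -
    have sw: "?T (\<lambda>u v. \<Sum>k\<in>K. f k u v) = (\<Sum>k\<in>K. ?T (f k))" for f :: "nat \<Rightarrow> site \<Rightarrow> site \<Rightarrow> real" and K
    proof -
      have "?T (\<lambda>u v. \<Sum>k\<in>K. f k u v) = (\<Sum>u\<in>Q. \<Sum>k\<in>K. \<Sum>v\<in>Q. J (zdiff u v) * f k u v)"
        unfolding sum_distrib_left by (intro sum.cong refl sum.swap)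
      also have "\<dots> = (\<Sum>k\<in>K. ?T (f k))" by (rule sum.swap)
      finally show ?thesis .
    qed
    have add: "?T (\<lambda>u v. f u v + 2 * g u v) = ?T f + 2 * ?T g" for f g
      by (simp add: distrib_left sum.distrib sum_distrib_left mult_ac)
    show ?thesis unfolding add sw ..
  qed
  also have "\<dots> \<le> (\<Sum>k\<in>S. 6 * W * L + 150 * W) + 2 * (\<Sum>k\<in>S. 2592 * W)"
  proof (intro add_mono mult_left_mono sum_mono)
    fix k assume k: "k \<in> S"
    have "?T (\<lambda>u v. (?d k u v)\<^sup>2) \<le> 6 * W * (spread J \<omega> k / (16 ^ k)\<^sup>2) + 150 * W"
      by (rule energy_profile_le[OF Q])
    also have "\<dots> \<le> 6 * W * L + 150 * W"
      using L[OF k] W_nonneg by (intro add_mono mult_left_mono) (auto simp: divide_le_eq)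
    finally show "?T (\<lambda>u v. (?d k u v)\<^sup>2) \<le> 6 * W * L + 150 * W" .
  next
    fix k assume k: "k \<in> S"
    have "(\<Sum>j\<in>{j\<in>S. j < k}. ?T (\<lambda>u v. \<bar>?d j u v\<bar> * \<bar>?d k u v\<bar>))
      \<le> (\<Sum>j\<in>{j\<in>S. j < k}. 2592 * W * (16 ^ j)\<^sup>2 / (16 ^ k)\<^sup>2)"
      by (intro sum_mono cross_energy_profile_le Q) auto
    also have "\<dots> = 2592 * W * (\<Sum>j\<in>{j\<in>S. j < k}. (16 ^ j)\<^sup>2 / (16 ^ k)\<^sup>2)"
      by (simp add: sum_distrib_left)
    also have "\<dots> \<le> 2592 * W * 1"
      using W_nonneg by (intro mult_left_mono sum_geometric_le S) auto
    finally show "(\<Sum>j\<in>{j\<in>S. j < k}. ?T (\<lambda>u v. \<bar>?d j u v\<bar> * \<bar>?d k u v\<bar>)) \<le> 2592 * W" by simp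
  qed simp
  \<comment> \<open>Here 5334 = 150 + 2 * 2592.\<close>
  also have "\<dots> = real (card S) * (6 * W * L + 5334 * W)" by (simp add: algebra_simps)
  finally show ?thesis .
qed

text \<open>Averaging over \<open>card S\<close> scales divides an energy that is linear in
  \<open>card S\<close> by its square. The remaining 2 in the denominator is the one half in
  \<open>energy\<close>.\<close>

lemma eff_energy_le:
  assumes S: "finite S" "S \<noteq> {}" and L: "\<And>k. k \<in> S \<Longrightarrow> spread J \<omega> k \<le> L * (16 ^ k)\<^sup>2"
    and nar: "\<And>k. k \<in> S \<Longrightarrow> narrow J \<omega> k" and x: "\<And>k. k \<in> S \<Longrightarrow> 4 * 16 ^ k \<le> norminf x"
    and L0: "0 \<le> L"
  shows "eff_energy J \<omega> x \<le> ennreal ((6 * W * L + 5334 * W) / (2 * real (card S)))"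
proof -
  define g where "g u = 1 - (\<Sum>k\<in>S. profile J \<omega> k u) / real (card S)" for u
  have cS: "0 < real (card S)" using S by (simp add: card_gt_0_iff)
  have "profile J \<omega> k (0, 0) = 0" for k by (rule profile_inner) (simp add: norminf_def)
  then have "g (0, 0) = 1" by (simp add: g_def)
  moreover have "g x = 0"
    using cS x by (simp add: g_def profile_outer)
  moreover have "g u = g v" if "shorted J \<omega> u v" for u v
  proof -
    have "(\<Sum>k\<in>S. profile J \<omega> k u) = (\<Sum>k\<in>S. profile J \<omega> k v)"
      using nar that by (intro sum.cong refl profile_shorted)
    then show ?thesis by (simp add: g_def)
  qed
  moreover have "energy J \<omega> g \<le> ennreal ((6 * W * L + 5334 * W) / (2 * real (card S)))"
  proof (subst energy_le_iff[OF J_nonneg], use W_nonneg L0 in simp, intro allI impI)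
    fix F assume F: "finite F" "F \<subseteq> live J \<omega>"
    \<comment> \<open>Completing \<open>F\<close> to a product set adds only nonnegative
      terms.\<close>
    define Q where "Q = fst ` F \<union> snd ` F"
    have Q: "finite Q" "F \<subseteq> Q \<times> Q" using F by (auto simp: Q_def image_iff) force+
    have diff: "(g u - g v)\<^sup>2 = (\<Sum>k\<in>S. profile J \<omega> k u - profile J \<omega> k v)\<^sup>2 / (real (card S))\<^sup>2" for u v
    proof -
      have "g u - g v = - (\<Sum>k\<in>S. profile J \<omega> k u - profile J \<omega> k v) / real (card S)"
        by (simp add: g_def sum_subtractf diff_divide_distrib)
      then show ?thesis by (simp add: power_divide)
    qed
    have "sum (edge_energy J g) F \<le> sum (edge_energy J g) (Q \<times> Q)"
      using Q J_nonneg by (intro sum_mono2) auto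
    also have "\<dots> = (\<Sum>u\<in>Q. \<Sum>v\<in>Q. J (zdiff u v) * (g u - g v)\<^sup>2)"
      by (simp add: sum.cartesian_product case_prod_beta)
    also have "\<dots> = (\<Sum>u\<in>Q. \<Sum>v\<in>Q. J (zdiff u v) * (\<Sum>k\<in>S. profile J \<omega> k u - profile J \<omega> k v)\<^sup>2) / (real (card S))\<^sup>2"
      by (simp add: diff sum_divide_distrib)
    also have "\<dots> \<le> (real (card S) * (6 * W * L + 5334 * W)) / (real (card S))\<^sup>2"
      by (intro divide_right_mono energy_sum_profile_le Q S L) auto
    also have "\<dots> = 2 * ((6 * W * L + 5334 * W) / (2 * real (card S)))"
      using cS by (simp add: power2_eq_square field_simps)
    finally show "sum (edge_energy J g) F \<le> 2 * ((6 * W * L + 5334 * W) / (2 * real (card S)))" .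
  qed
  ultimately show ?thesis
    unfolding eff_energy_def by (intro INF_lower2[of g]) auto
qed

end

section \<open>Most scales are good\<close>

text \<open>The base is 256 = 16 * 16 because scales below \<open>2 * m\<close> are used, and
  \<open>16 ^ (2 * m) = 256 ^ m\<close> has to stay within the distance \<open>N\<close>.\<close>

lemma scale_exists:
  assumes "256 \<le> (N :: real)"
  obtains m where "1 \<le> m" "256 ^ m \<le> N" "N < 256 ^ Suc m"
proof
  let ?l = "log 256 N"
  have l: "1 \<le> ?l" using assms by (simp add: le_log_iff)
  define m where "m = nat \<lfloor>?l\<rfloor>"
  have m: "real m \<le> ?l" "?l < real m + 1" using l unfolding m_def by linarith+
  show "1 \<le> m" using l unfolding m_def by linarith
  have "256 powr real m \<le> N" using m(1) assms by (simp add: le_log_iff)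
  then show "256 ^ m \<le> N" by (simp add: powr_realpow)
  have "N < 256 powr real (Suc m)" using m(2) assms by (simp add: log_less_iff add.commute)
  then show "N < 256 ^ Suc m" by (simp only: powr_realpow)
qed

context subcritical_network
begin

lemma determined_by_spread: "determined_by (edges_in J (annulus k)) (\<lambda>\<omega>. c \<le> spread J \<omega> k)"
proof (unfold determined_by_def, intro allI impI)
  fix \<omega> \<omega>' :: "site \<times> site \<Rightarrow> bool"
  assume "\<forall>e\<in>edges_in J (annulus k). \<omega> e = \<omega>' e"
  then have "conn J \<omega> (annulus k) = conn J \<omega>' (annulus k)" by (intro conn_cong) auto
  then show "(c \<le> spread J \<omega> k) = (c \<le> spread J \<omega>' k)" by (simp add: spread_def)
qed

text \<open>The weight dominates the squared distance, so each site of the annulus contributes at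
  most 2 in expectation; 162 = 2 * 81 comes from the area.\<close>

lemma expectation_spread:
  "integrable P (\<lambda>\<omega>. spread J \<omega> k)" "expectation (\<lambda>\<omega>. spread J \<omega> k) \<le> 162 * (16 ^ k)\<^sup>2"
proof -
  let ?A = "annulus k"
  let ?c = "\<lambda>u v. {\<omega> \<in> space P. conn J \<omega> ?A u v}"
  let ?f = "\<lambda>\<omega>. \<Sum>u\<in>?A. \<Sum>v\<in>?A. indicator (?c u v) \<omega> * (sdist u v)\<^sup>2"
  have eq: "spread J \<omega> k = ?f \<omega>" if "\<omega> \<in> space P" for \<omega>
    using that unfolding spread_def indicator_def by simp
  have ind: "integrable P (\<lambda>\<omega>. indicator (?c u v) \<omega> * (sdist u v)\<^sup>2 :: real)" for u v
    using conn_event[of ?A u v]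
    by (intro integrable_mult_left integrable_real_indicator) (auto simp: emeasure_eq_measure)
  have int: "integrable P ?f" by (intro Bochner_Integration.integrable_sum ind)
  then show "integrable P (\<lambda>\<omega>. spread J \<omega> k)"
    by (subst Bochner_Integration.integrable_cong[OF refl eq])
  have "expectation (\<lambda>\<omega>. spread J \<omega> k) = expectation ?f"
    using eq by (intro Bochner_Integration.integral_cong) auto
  also have "\<dots> = (\<Sum>u\<in>?A. \<Sum>v\<in>?A. expectation (\<lambda>\<omega>. indicator (?c u v) \<omega> * (sdist u v)\<^sup>2))"
    by (simp only: Bochner_Integration.integral_sum Bochner_Integration.integrable_sum ind)
  also have "\<dots> = (\<Sum>u\<in>?A. \<Sum>v\<in>?A. \<tau> ?A u v * (sdist u v)\<^sup>2)"
    using conn_event[of ?A] by (intro sum.cong refl) (simp add: \<tau>_def Int_absorb2 subset_eq)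
  also have "\<dots> \<le> (\<Sum>u\<in>?A. \<Sum>v\<in>?A. \<tau> ?A u v * (1 + sdist u v) powr s)"
    using \<tau>_bounds by (intro sum_mono mult_left_mono square_le_weight) auto
  also have "\<dots> \<le> (\<Sum>u\<in>?A. 2)"
    by (intro sum_mono sum_\<tau>_weight_le) auto
  also have "\<dots> = 2 * real (card ?A)" by simp
  also have "\<dots> \<le> 2 * real (card (sbox (4 * 16 ^ k)))"
    using card_mono[OF finite_box annulus_subset] by simp
  also have "\<dots> \<le> 2 * (81 * (16 ^ k)\<^sup>2)"
    using card_box_pow16[of 4 k] by (intro mult_left_mono) auto
  finally show "expectation (\<lambda>\<omega>. spread J \<omega> k) \<le> 162 * (16 ^ k)\<^sup>2" by simp
qed

lemma spread_nonneg: "0 \<le> spread J \<omega> k"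
  unfolding spread_def by (intro sum_nonneg) auto

text \<open>The constant \<open>2592 = 16 * 162\<close> makes a scale bad with probability at most \<open>1/16\<close>.\<close>

definition bad :: "nat \<Rightarrow> (site \<times> site \<Rightarrow> bool) \<Rightarrow> bool" where
  "bad k \<omega> \<longleftrightarrow> 2592 * (16 ^ k)\<^sup>2 \<le> spread J \<omega> k"

lemma determined_by_bad: "determined_by (edges_in J (annulus k)) (bad k)"
  using determined_by_spread unfolding bad_def[abs_def] .

lemma bad_event: "{\<omega> \<in> space P. bad k \<omega>} \<in> events"
  by (rule events_determined_by[OF finite_edges_in edges_in_subset determined_by_bad]) simp

lemma prob_bad_le: "prob {\<omega> \<in> space P. bad k \<omega>} \<le> 1 / 16"
proof -
  have "prob {\<omega> \<in> space P. bad k \<omega>} \<le> expectation (\<lambda>\<omega>. spread J \<omega> k) / (2592 * (16 ^ k)\<^sup>2)"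
    unfolding bad_def
    by (rule integral_Markov_inequality_measure[OF expectation_spread(1), of "{}"])
       (auto simp: spread_nonneg)
  also have "\<dots> \<le> 162 * (16 ^ k)\<^sup>2 / (2592 * (16 ^ k)\<^sup>2)"
    by (intro divide_right_mono expectation_spread) auto
  also have "\<dots> = 1 / 16" by simp
  finally show ?thesis .
qed

text \<open>Badness at different scales is decided by edges inside disjoint annuli, hence
  independent.\<close>

lemma prob_all_bad_le:
  assumes "finite S"
  shows "prob {\<omega> \<in> space P. \<forall>k\<in>S. bad k \<omega>} \<le> (1 / 16) ^ card S"
proof -
  have "prob {\<omega> \<in> space P. \<forall>k\<in>S. bad k \<omega>} = (\<Prod>k\<in>S. prob {\<omega> \<in> space P. bad k \<omega>})"
  proof (rule prob_Ball_determined_by'[OF assms _ _ _ determined_by_bad])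
    show "disjoint_family_on (\<lambda>k. edges_in J (annulus k)) S"
      unfolding disjoint_family_on_def edges_in_def using annulus_disjoint by blast
  qed (auto simp: finite_edges_in edges_in_subset[THEN subsetD])
  also have "\<dots> \<le> (\<Prod>k\<in>S. 1 / 16)" by (intro prod_mono conjI prob_bad_le measure_nonneg)
  finally show ?thesis by simp
qed

definition mostly_bad :: "nat \<Rightarrow> (site \<times> site \<Rightarrow> bool) set" where
  "mostly_bad m = {\<omega> \<in> space P. m \<le> 2 * card {k \<in> {m..<2 * m}. bad k \<omega>}}"

text \<open>Union bound over the at most \<open>2 ^ m\<close> sets of at least \<open>m / 2\<close>
  scales; each is entirely bad with probability at most \<open>(1 / 16) powr (m / 2)\<close>, that
  is \<open>(1 / 4) ^ m\<close>.\<close>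

lemma mostly_bad: "mostly_bad m \<in> events" "prob (mostly_bad m) \<le> (1 / 2) ^ m"
proof -
  let ?T = "{S. S \<subseteq> {m..<2 * m} \<and> m \<le> 2 * card S}"
  let ?B = "\<lambda>S. {\<omega> \<in> space P. \<forall>k\<in>S. bad k \<omega>}"
  have finT: "finite ?T" by (rule finite_subset[of _ "Pow {m..<2 * m}"]) auto
  have finS: "finite S" if "S \<in> ?T" for S using that finite_subset by auto
  have B: "?B S \<in> events" if "S \<in> ?T" for S
    by (intro sets.sets_Collect_finite_All bad_event finS[OF that])
  have eq: "mostly_bad m = (\<Union>S\<in>?T. ?B S)"
  proof (intro equalityI subsetI)
    fix \<omega> assume "\<omega> \<in> mostly_bad m"
    then show "\<omega> \<in> (\<Union>S\<in>?T. ?B S)"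
      by (intro UN_I[of "{k \<in> {m..<2 * m}. bad k \<omega>}"]) (auto simp: mostly_bad_def)
  next
    fix \<omega> assume "\<omega> \<in> (\<Union>S\<in>?T. ?B S)"
    then obtain S where S: "S \<in> ?T" "\<omega> \<in> ?B S" by blast
    then have "card S \<le> card {k \<in> {m..<2 * m}. bad k \<omega>}"
      by (intro card_mono) auto
    then show "\<omega> \<in> mostly_bad m" using S by (auto simp: mostly_bad_def)
  qed
  show "mostly_bad m \<in> events" unfolding eq using finT B by (intro sets.finite_UN) auto
  have "prob (mostly_bad m) \<le> (\<Sum>S\<in>?T. prob (?B S))"
    unfolding eq using finT B by (intro finite_measure_subadditive_finite) auto
  also have "\<dots> \<le> (\<Sum>S\<in>?T. (1 / 4) ^ m)"
  proof (intro sum_mono)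
    fix S assume S: "S \<in> ?T"
    have "prob (?B S) \<le> (1 / 16) ^ card S" by (rule prob_all_bad_le[OF finS[OF S]])
    also have "\<dots> = (1 / 4) ^ (2 * card S)" by (simp add: power_mult power2_eq_square)
    also have "\<dots> \<le> (1 / 4) ^ m" using S by (intro power_decreasing) auto
    finally show "prob (?B S) \<le> (1 / 4) ^ m" .
  qed
  also have "\<dots> = real (card ?T) * (1 / 4) ^ m" by simp
  also have "\<dots> \<le> 2 ^ m * (1 / 4) ^ m"
  proof (intro mult_right_mono)
    have "card ?T \<le> card (Pow {m..<2 * m})" by (intro card_mono) auto
    then have "card ?T \<le> 2 ^ m" by (simp add: card_Pow)
    then show "real (card ?T) \<le> 2 ^ m" by (metis of_nat_le_iff of_nat_numeral of_nat_power)
  qed simp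
  also have "\<dots> = (1 / 2) ^ m" by (simp add: power_mult_distrib[symmetric])
  finally show "prob (mostly_bad m) \<le> (1 / 2) ^ m" .
qed

text \<open>The number of starting sites, of order \<open>16 ^ (2 * k)\<close>, competes with the
  tail of order \<open>16 powr (- s * k)\<close>.\<close>

lemma not_narrow:
  "{\<omega> \<in> space P. \<not> narrow J \<omega> k} \<in> events"
  "prob {\<omega> \<in> space P. \<not> narrow J \<omega> k} \<le> 162 * 4 powr s * (16 powr (2 - s)) ^ k"
proof -
  let ?B = "sbox (4 * 16 ^ k)"
  have eq: "{\<omega> \<in> space P. \<not> narrow J \<omega> k} = (\<Union>u\<in>?B. wide_cluster (16 ^ k / 4) u)"
    unfolding narrow_def wide_cluster_def not_less[symmetric] by blast
  show "{\<omega> \<in> space P. \<not> narrow J \<omega> k} \<in> events"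
    unfolding eq by (intro sets.finite_UN wide_cluster) auto
  have "prob {\<omega> \<in> space P. \<not> narrow J \<omega> k} \<le> (\<Sum>u\<in>?B. prob (wide_cluster (16 ^ k / 4) u))"
    unfolding eq by (intro finite_measure_subadditive_finite) (auto intro!: wide_cluster)
  also have "\<dots> \<le> (\<Sum>u\<in>?B. 2 / (16 ^ k / 4) powr s)"
    by (intro sum_mono wide_cluster) auto
  also have "\<dots> = real (card ?B) * (2 / (16 ^ k / 4) powr s)" by simp
  also have "\<dots> \<le> (81 * (16 ^ k)\<^sup>2) * (2 / (16 ^ k / 4) powr s)"
    using card_box_pow16[of 4 k] by (intro mult_right_mono) auto
  also have "\<dots> = 162 * 4 powr s * ((16 ^ k) powr 2 * (16 ^ k) powr (- s))"
    by (simp add: powr_divide powr_minus field_simps powr_numeral)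
  also have "(16 ^ k) powr 2 * (16 ^ k) powr (- s) = (16 ^ k :: real) powr (2 - s)"
    by (simp only: powr_add[symmetric]) simp
  also have "\<dots> = (16 powr (2 - s)) ^ k"
    by (simp add: powr_realpow[symmetric] powr_powr mult.commute)
  finally show "prob {\<omega> \<in> space P. \<not> narrow J \<omega> k} \<le> 162 * 4 powr s * (16 powr (2 - s)) ^ k" .
qed

definition some_wide :: "nat \<Rightarrow> (site \<times> site \<Rightarrow> bool) set" where
  "some_wide m = {\<omega> \<in> space P. \<exists>k\<in>{m..<2 * m}. \<not> narrow J \<omega> k}"

text \<open>A union bound suffices without independence, since the failure probabilities decay
  geometrically in the scale.\<close>

lemma some_wide:
  "some_wide m \<in> events"
  "prob (some_wide m) \<le> 162 * 4 powr s / (1 - 16 powr (2 - s)) * (16 powr (2 - s)) ^ m"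
proof -
  let ?q = "16 powr (2 - s)"
  have q: "0 < ?q" "?q < 1" using s by (auto intro: powr_less_one)
  have eq: "some_wide m = (\<Union>k\<in>{m..<2 * m}. {\<omega> \<in> space P. \<not> narrow J \<omega> k})"
    by (auto simp: some_wide_def)
  show "some_wide m \<in> events" unfolding eq by (intro sets.finite_UN not_narrow) auto
  have "prob (some_wide m) \<le> (\<Sum>k\<in>{m..<2 * m}. prob {\<omega> \<in> space P. \<not> narrow J \<omega> k})"
    unfolding eq by (intro finite_measure_subadditive_finite) (auto intro!: not_narrow)
  also have "\<dots> \<le> (\<Sum>k\<in>{m..<2 * m}. 162 * 4 powr s * ?q ^ k)"
    by (intro sum_mono not_narrow)
  also have "\<dots> = 162 * 4 powr s * (\<Sum>k\<in>{m..<2 * m}. ?q ^ k)" by (simp add: sum_distrib_left)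
  also have "(\<Sum>k\<in>{m..<2 * m}. ?q ^ k) = (\<Sum>i<m. ?q ^ (i + m))"
    using sum.shift_bounds_nat_ivl[of "\<lambda>k. ?q ^ k" 0 m m] by (simp add: atLeast0LessThan mult_2)
  also have "\<dots> = ?q ^ m * (\<Sum>i<m. ?q ^ i)"
    by (simp add: power_add sum_distrib_left mult.commute)
  also have "\<dots> \<le> ?q ^ m * (1 / (1 - ?q))"
  proof (intro mult_left_mono)
    have "(\<Sum>i<m. ?q ^ i) = (1 - ?q ^ m) / (1 - ?q)"
      using q s sum_gp_strict[of ?q m] by simp
    also have "\<dots> \<le> 1 / (1 - ?q)" using q by (intro divide_right_mono) auto
    finally show "(\<Sum>i<m. ?q ^ i) \<le> 1 / (1 - ?q)" .
  qed (use q in simp)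
  finally show "prob (some_wide m) \<le> 162 * 4 powr s / (1 - ?q) * ?q ^ m"
    by (simp add: mult_ac)
qed

text \<open>The test function averages over the good scales, which make up at least half of the
  \<open>m\<close> scales; 20886 = 6 * 2592 + 5334.\<close>

lemma eff_energy_le_inverse_scales:
  assumes m: "1 \<le> m" and N: "256 ^ m \<le> norminf x"
    and \<omega>: "\<omega> \<in> space P" "\<omega> \<notin> mostly_bad m" "\<omega> \<notin> some_wide m"
  shows "eff_energy J \<omega> x \<le> ennreal (20886 * W / real m)"
proof -
  let ?G = "{k \<in> {m..<2 * m}. \<not> bad k \<omega>}" and ?B = "{k \<in> {m..<2 * m}. bad k \<omega>}"
  have "card ?G + card ?B = card (?G \<union> ?B)" by (intro card_Un_disjoint[symmetric]) auto
  also have "?G \<union> ?B = {m..<2 * m}" by auto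
  finally have cG: "m \<le> 2 * card ?G" using \<omega>(1,2) by (simp add: mostly_bad_def)
  then have "0 < card ?G" using m by linarith
  then have ne: "?G \<noteq> {}" by (metis card.empty less_irrefl)
  have "eff_energy J \<omega> x \<le> ennreal ((6 * W * 2592 + 5334 * W) / (2 * real (card ?G)))"
  proof (rule eff_energy_le[OF _ ne])
    fix k assume k: "k \<in> ?G"
    show "spread J \<omega> k \<le> 2592 * (16 ^ k)\<^sup>2" using k by (auto simp: bad_def)
    show "narrow J \<omega> k" using k \<omega> by (auto simp: some_wide_def)
    \<comment> \<open>Every scale is at most \<open>2 * m - 1\<close>, so all annuli lie within
      radius \<open>256 ^ m\<close> and \<open>x\<close> lies beyond them.\<close>
    have "4 * 16 ^ k \<le> (16 ^ Suc k :: real)" by simp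
    also have "\<dots> \<le> 16 ^ (2 * m)" using k by (intro power_increasing) auto
    also have "\<dots> = 256 ^ m" by (simp add: power_mult)
    finally show "4 * 16 ^ k \<le> norminf x" using N by simp
  qed auto
  also have "\<dots> \<le> ennreal (20886 * W / real m)"
  proof (rule ennreal_leI)
    have "(20886 * W) / (2 * real (card ?G)) \<le> 20886 * W / real m"
      using cG m W_nonneg by (intro frac_le) (simp_all flip: of_nat_le_iff)
    then show "(6 * W * 2592 + 5334 * W) / (2 * real (card ?G)) \<le> 20886 * W / real m" by simp
  qed
  finally show ?thesis .
qed

section \<open>The logarithmic lower bound\<close>

theorem eff_resistance_ge_log:
  "\<exists>C \<kappa> c. \<kappa> > 0 \<and> c > 0 \<and> (\<forall>x. norminf x \<ge> 2 \<longrightarrow>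
     prob {\<omega> \<in> space P. ennreal (c * ln (norminf x)) \<le> eff_resistance J \<omega> x}
       \<ge> 1 - C / norminf x powr \<kappa>)"
proof -
  let ?q = "16 powr (2 - s)"
  define C1 where "C1 = 162 * 4 powr s / (1 - ?q)"
  \<comment> \<open>The two failure probabilities decay like
    \<open>2 powr (- m) = 256 powr (- m / 8)\<close> and
    \<open>16 powr ((2 - s) * m) = 256 powr (- (s - 2) / 2 * m)\<close>; the slower rate
    wins.\<close>
  define \<kappa> where "\<kappa> = min (1 / 8) ((s - 2) / 2)"
  \<comment> \<open>The added 1 keeps \<open>A\<close> positive when only \<open>0 \<le> W\<close>
    is known.\<close>
  define A where "A = 20886 * W + 1"
  \<comment> \<open>Chosen so that \<open>ln (norminf x) \<le> 2 * m * ln 256\<close> gives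
    \<open>c * ln (norminf x) \<le> m / A\<close>.\<close>
  define c where "c = 1 / (2 * ln 256 * A)"
  \<comment> \<open>The factor \<open>256 powr \<kappa>\<close> pays for rounding
    \<open>norminf x\<close> down to a power of 256.\<close>
  define C where "C = (C1 + 1) * 256 powr \<kappa>"
  have q: "0 < ?q" "?q < 1" using s by (auto intro: powr_less_one)
  have C1: "0 \<le> C1" using q by (simp add: C1_def)
  have \<kappa>: "0 < \<kappa>" "\<kappa> \<le> 1 / 8" "\<kappa> \<le> (s - 2) / 2"
    unfolding \<kappa>_def using s min.cobounded1 min.cobounded2 by (simp, blast+)
  have A: "0 < A" using W_nonneg by (simp add: A_def)
  have c: "0 < c" using A by (simp add: c_def)
  have "1 - C / norminf x powr \<kappa>
      \<le> prob {\<omega> \<in> space P. ennreal (c * ln (norminf x)) \<le> eff_resistance J \<omega> x}"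
    if x: "2 \<le> norminf x" for x
  proof (cases "256 \<le> norminf x")
    \<comment> \<open>At such short distances \<open>C\<close> makes the claimed lower bound
      nonpositive.\<close>
    case False
    have "norminf x powr \<kappa> \<le> 256 powr \<kappa>" using False x \<kappa> by (intro powr_mono2) auto
    also have "\<dots> \<le> C" using C1 by (simp add: C_def)
    finally have "1 \<le> C / norminf x powr \<kappa>" using x by (simp add: le_divide_eq)
    then show ?thesis by (intro order_trans[OF _ measure_nonneg]) simp
  next
    case True
    then obtain m where m: "1 \<le> m" "256 ^ m \<le> norminf x" "norminf x < 256 ^ Suc m"
      using scale_exists by blast
    let ?E = "{\<omega> \<in> space P. ennreal (c * ln (norminf x)) \<le> eff_resistance J \<omega> x}"
    let ?U = "mostly_bad m \<union> some_wide m"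
    have ln_pos: "0 < ln (norminf x)" using x by simp
    have "ln (norminf x) \<le> ln (256 ^ Suc m)" using m x by (subst ln_le_cancel_iff) auto
    also have "\<dots> = real (Suc m) * ln 256" by (rule ln_realpow)
    also have "\<dots> \<le> (2 * real m) * ln 256" using m by (intro mult_right_mono) auto
    finally have "c * ln (norminf x) \<le> c * (2 * real m * ln 256)" using c by simp
    also have "\<dots> = real m / A" using A by (simp add: c_def)
    finally have cln: "c * ln (norminf x) \<le> real m / A" .
    have "space P - ?U \<subseteq> ?E"
    proof
      fix \<omega> assume \<omega>: "\<omega> \<in> space P - ?U"
      then have "eff_energy J \<omega> x \<le> ennreal (20886 * W / real m)"
        by (intro eff_energy_le_inverse_scales m) auto
      also have "\<dots> \<le> ennreal (1 / (c * ln (norminf x)))"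
      proof (rule ennreal_leI)
        have "20886 * W / real m \<le> A / real m" by (intro divide_right_mono) (auto simp: A_def)
        also have "\<dots> = 1 / (real m / A)" by simp
        also have "\<dots> \<le> 1 / (c * ln (norminf x))"
          using cln c ln_pos by (intro divide_left_mono mult_pos_pos) (auto intro: less_le_trans[OF mult_pos_pos])
        finally show "20886 * W / real m \<le> 1 / (c * ln (norminf x))" .
      qed
      finally show "\<omega> \<in> ?E"
        using \<omega> c ln_pos by (simp add: le_eff_resistance_iff)
    qed
    moreover have "?E \<in> events" using c ln_pos by (intro eff_resistance_event) simp
    ultimately have "prob (space P - ?U) \<le> prob ?E" by (rule finite_measure_mono)
    moreover have "prob (space P - ?U) = 1 - prob ?U"
      by (intro prob_compl sets.Un mostly_bad some_wide)
    moreover have "prob ?U \<le> prob (mostly_bad m) + prob (some_wide m)"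
      by (intro measure_subadditive mostly_bad some_wide) (auto simp: emeasure_eq_measure)
    moreover have "prob (mostly_bad m) \<le> 256 powr (- \<kappa> * real m)"
    proof -
      have "prob (mostly_bad m) \<le> (1 / 2) ^ m" by (rule mostly_bad)
      also have "\<dots> = 2 powr (- real m)" by (simp add: powr_minus powr_realpow power_one_over inverse_eq_divide)
      also have "\<dots> = (2 powr 8) powr (- (1 / 8) * real m)" by (simp only: powr_powr) simp
      also have "\<dots> = 256 powr (- (1 / 8) * real m)" by simp
      also have "\<dots> \<le> 256 powr (- \<kappa> * real m)"
        using \<kappa> by (intro powr_mono mult_right_mono) auto
      finally show ?thesis .
    qed
    moreover have "prob (some_wide m) \<le> C1 * 256 powr (- \<kappa> * real m)"
    proof -
      have "prob (some_wide m) \<le> C1 * ?q ^ m" unfolding C1_def by (rule some_wide)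
      also have "?q ^ m = 16 powr ((2 - s) * real m)"
        using q by (simp add: powr_realpow[symmetric] powr_powr)
      also have "\<dots> = (16 powr 2) powr (- ((s - 2) / 2) * real m)" 
      proof -
        have "(2 - s) * real m = 2 * (- ((s - 2) / 2) * real m)"
          by (simp add: algebra_simps diff_divide_distrib)
        then show ?thesis by (simp only: powr_powr)
      qed
      also have "\<dots> = 256 powr (- ((s - 2) / 2) * real m)" by simp
      also have "C1 * \<dots> \<le> C1 * 256 powr (- \<kappa> * real m)"
        using \<kappa> C1 by (intro mult_left_mono powr_mono mult_right_mono) auto
      finally show ?thesis .
    qed
    moreover have "256 powr (- \<kappa> * real m) \<le> 256 powr \<kappa> / norminf x powr \<kappa>"
    proof -
      have "norminf x powr \<kappa> \<le> (256 ^ Suc m) powr \<kappa>"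
        using m x \<kappa> by (intro powr_mono2) auto
      also have "(256 ^ Suc m :: real) = 256 powr (real (Suc m))" by (subst powr_realpow) auto
      also have "\<dots> powr \<kappa> = 256 powr (\<kappa> + \<kappa> * real m)" by (simp add: powr_powr algebra_simps)
      finally have "256 powr (- \<kappa> * real m) * norminf x powr \<kappa>
          \<le> 256 powr (- \<kappa> * real m) * 256 powr (\<kappa> + \<kappa> * real m)" by (intro mult_left_mono) auto
      also have "\<dots> = 256 powr \<kappa>" by (simp add: powr_add[symmetric])
      finally show ?thesis using x by (simp add: le_divide_eq)
    qed
    then have "(C1 + 1) * 256 powr (- \<kappa> * real m) \<le> C / norminf x powr \<kappa>"
      using C1 mult_left_mono[of "256 powr (- \<kappa> * real m)" "256 powr \<kappa> / norminf x powr \<kappa>" "C1 + 1"]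
      by (simp add: C_def)
    ultimately show ?thesis by (simp add: distrib_right)
  qed
  then show ?thesis using \<kappa> c by blast
qed

end

section \<open>Summability of the weighted couplings\<close>

lemma sum_powr_int_bounded:
  assumes "1 < (b::real)"
  shows "\<exists>B. \<forall>n. (\<Sum>a\<in>{- int n..int n}. (1 + real_of_int \<bar>a\<bar>) powr (- b)) \<le> B"
proof -
  let ?f = "\<lambda>i::nat. (1 + real i) powr (- b)"
  have "summable (\<lambda>i. real i powr (- b))" using assms by (subst summable_real_powr_iff) auto
  then have summ: "summable ?f"
    using summable_Suc_iff[of "\<lambda>i. real i powr (- b)"] by (simp add: add.commute)
  have "(\<Sum>a\<in>{- int n..int n}. (1 + real_of_int \<bar>a\<bar>) powr (- b)) \<le> 2 * suminf ?f" for n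
  proof -
    let ?g = "\<lambda>a. (1 + real_of_int \<bar>a\<bar>) powr (- b)"
    have "{- int n..int n} = int ` {..n} \<union> (\<lambda>i. - int i) ` {..n}"
    proof (intro equalityI subsetI)
      fix a assume "a \<in> {- int n..int n}"
      then show "a \<in> int ` {..n} \<union> (\<lambda>i. - int i) ` {..n}"
        by (cases "0 \<le> a") (auto intro: image_eqI[of _ _ "nat a"] image_eqI[of _ _ "nat (- a)"])
    qed auto
    then have "sum ?g {- int n..int n} \<le> sum ?g (int ` {..n}) + sum ?g ((\<lambda>i. - int i) ` {..n})"
      using sum_Un[of "int ` {..n}" "(\<lambda>i. - int i) ` {..n}" ?g]
        sum_nonneg[of "int ` {..n} \<inter> (\<lambda>i. - int i) ` {..n}" ?g] by simp
    also have "sum ?g (int ` {..n}) = sum ?f {..n}" by (subst sum.reindex) (auto simp: inj_on_def)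
    also have "sum ?g ((\<lambda>i. - int i) ` {..n}) = sum ?f {..n}"
      by (subst sum.reindex) (auto simp: inj_on_def)
    also have "sum ?f {..n} \<le> suminf ?f"
      by (intro sum_le_suminf summ) auto
    finally show ?thesis by simp
  qed
  then show ?thesis by blast
qed

text \<open>The weight with exponent \<open>\<alpha> / 2\<close> leaves decay of order
  \<open>\<alpha> / 2\<close> in the norm. Half of it is given to each coordinate, and
  \<open>\<alpha> / 4 > 1\<close> makes both one-dimensional series converge.\<close>

lemma weighted_coupling_bounded:
  fixes J :: "site \<Rightarrow> real"
  assumes \<alpha>: "4 < \<alpha>" and Jc: "0 \<le> Jc"
    and J: "\<And>x. x \<noteq> (0, 0) \<Longrightarrow> J x \<le> Jc * norm1 x powr (- \<alpha>)" and J0: "\<And>x. 0 \<le> J x"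
  shows "\<exists>W. \<forall>F. finite F \<longrightarrow> (\<Sum>x\<in>F. J x * (1 + norminf x) powr (\<alpha> / 2)) \<le> W"
proof -
  let ?w = "\<lambda>x. (1 + norminf x) powr (\<alpha> / 2)"
  let ?h = "\<lambda>a. (1 + real_of_int \<bar>a\<bar>) powr (- (\<alpha> / 4))"
  obtain B where B: "(\<Sum>a\<in>{- int n..int n}. ?h a) \<le> B" for n
    using sum_powr_int_bounded[of "\<alpha> / 4"] \<alpha> by auto
  have pw: "J x * ?w x \<le> Jc * 2 powr \<alpha> * (?h (fst x) * ?h (snd x))" if x: "x \<noteq> (0, 0)" for x
  proof -
    let ?N = "norminf x"
    have N1: "1 \<le> ?N" using sdist_ge_one[OF x] by (simp add: zdiff_def)
    have "norm1 x powr (- \<alpha>) \<le> ?N powr (- \<alpha>)"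
      using N1 \<alpha> by (intro powr_mono2') (auto simp: norm1_def norminf_def)
    also have "\<dots> \<le> ((1 + ?N) / 2) powr (- \<alpha>)" using N1 \<alpha> by (intro powr_mono2') auto
    also have "\<dots> = 2 powr \<alpha> * (1 + ?N) powr (- \<alpha>)"
      using N1 by (simp add: powr_divide powr_minus field_simps)
    finally have "J x \<le> Jc * (2 powr \<alpha> * (1 + ?N) powr (- \<alpha>))"
      using J[OF x] Jc by (meson mult_left_mono order_trans)
    then have "J x * ?w x \<le> Jc * (2 powr \<alpha> * (1 + ?N) powr (- \<alpha>)) * ?w x"
      by (intro mult_right_mono) auto
    also have "\<dots> = Jc * 2 powr \<alpha> * (1 + ?N) powr (- (\<alpha> / 4) + - (\<alpha> / 4))"
      by (simp add: powr_add[symmetric] mult.assoc)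
    also have "\<dots> = Jc * 2 powr \<alpha> * ((1 + ?N) powr (- (\<alpha> / 4)) * (1 + ?N) powr (- (\<alpha> / 4)))"
      by (simp only: powr_add)
    also have "\<dots> \<le> Jc * 2 powr \<alpha> * (?h (fst x) * ?h (snd x))"
      using \<alpha> Jc by (intro mult_left_mono mult_mono powr_mono2') (auto simp: norminf_def)
    finally show ?thesis .
  qed
  have "(\<Sum>x\<in>F. J x * ?w x) \<le> J (0, 0) + Jc * 2 powr \<alpha> * (B * B)" if F: "finite F" for F
  proof -
    obtain n where n: "F \<subseteq> sbox n" using finite_subset_box[OF F] by blast
    \<comment> \<open>The origin is split off because the decay hypothesis says nothing
      there.\<close>
    have "(\<Sum>x\<in>F. J x * ?w x) \<le> (\<Sum>x\<in>insert (0, 0) F. J x * ?w x)"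
      using F J0 by (intro sum_mono2) auto
    also have "\<dots> = J (0, 0) + (\<Sum>x\<in>F - {(0, 0)}. J x * ?w x)"
      using F by (simp add: sum.insert_remove norminf_def)
    also have "(\<Sum>x\<in>F - {(0, 0)}. J x * ?w x)
        \<le> (\<Sum>x\<in>F - {(0, 0)}. Jc * 2 powr \<alpha> * (?h (fst x) * ?h (snd x)))"
      by (intro sum_mono pw) auto
    also have "\<dots> \<le> (\<Sum>x\<in>sbox n. Jc * 2 powr \<alpha> * (?h (fst x) * ?h (snd x)))"
      using n Jc by (intro sum_mono2) auto
    also have "\<dots> = Jc * 2 powr \<alpha> * (\<Sum>x\<in>sbox n. ?h (fst x) * ?h (snd x))"
      by (simp add: sum_distrib_left)
    also have "(\<Sum>x\<in>sbox n. ?h (fst x) * ?h (snd x))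
        = (\<Sum>a\<in>{- int n..int n}. ?h a) * (\<Sum>a\<in>{- int n..int n}. ?h a)"
      unfolding sbox_def by (simp add: sum_product sum.cartesian_product case_prod_beta)
    also have "\<dots> \<le> B * B"
    proof (intro mult_mono B)
      show nn: "0 \<le> (\<Sum>a\<in>{- int n..int n}. ?h a)" by (intro sum_nonneg) simp
      then show "0 \<le> B" using B[of n] by linarith
    qed
    finally show ?thesis using Jc by (simp add: mult_left_mono)
  qed
  then show ?thesis by blast
qed

theorem theorem2:
  fixes J :: "site \<Rightarrow> real"
  assumes nonneg: "\<forall>x. J x \<ge> 0"
    and symm: "\<forall>x. J x = J (- fst x, - snd x)"
    and sum1: "(J has_sum 1) UNIV"
    and A1: "\<exists>\<alpha> > 4. \<exists>Jc \<ge> 0. \<forall>x. x \<noteq> (0, 0) \<longrightarrow> J x \<le> Jc * norm1 x powr (- \<alpha>)"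
  shows "\<exists>\<epsilon>0 > 0. \<forall>\<epsilon>. 0 < \<epsilon> \<and> \<epsilon> < \<epsilon>0 \<longrightarrow>
           (\<exists>C \<kappa> c. \<kappa> > 0 \<and> c > 0 \<and>
              (\<forall>x. norminf x \<ge> 2 \<longrightarrow>
                 measure (network J \<epsilon>)
                   {\<omega> \<in> space (network J \<epsilon>). ennreal (c * ln (norminf x)) \<le> eff_resistance J \<omega> x}
                 \<ge> 1 - C / norminf x powr \<kappa>))"
proof -
  obtain \<alpha> Jc where \<alpha>: "4 < \<alpha>" "0 \<le> Jc" "\<And>x. x \<noteq> (0, 0) \<Longrightarrow> J x \<le> Jc * norm1 x powr (- \<alpha>)"
    using A1 by blast
  have sym': "J (- fst x, - snd x) = J x" for x using symm by metis
  obtain W where W: "\<And>F. finite F \<Longrightarrow> (\<Sum>x\<in>F. J x * (1 + norminf x) powr (\<alpha> / 2)) \<le> W"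
    using weighted_coupling_bounded[of \<alpha> Jc J] \<alpha> nonneg by blast
  have W0: "0 \<le> W" using W[of "{}"] by simp
  show ?thesis
  \<comment> \<open>This threshold enforces \<open>2 * \<epsilon> * W \<le> 1\<close>;
    \<open>W + 1\<close> avoids a division by zero.\<close>
  proof (rule exI[of _ "1 / (2 * (W + 1))"], intro conjI allI impI)
    show "0 < 1 / (2 * (W + 1))" using W0 by simp
    fix \<epsilon> assume \<epsilon>: "0 < \<epsilon> \<and> \<epsilon> < 1 / (2 * (W + 1))"
    then have "2 * \<epsilon> * (W + 1) < 1" using W0 by (simp add: field_simps)
    then have "2 * \<epsilon> * W \<le> 1" using \<epsilon> by (simp add: distrib_left)
    then interpret subcritical_network J "\<alpha> / 2" W \<epsilon>
      using nonneg \<alpha>(1) W \<epsilon> by unfold_locales (simp_all add: sym' del: split_paired_All)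
    show "\<exists>C \<kappa> c. \<kappa> > 0 \<and> c > 0 \<and>
              (\<forall>x. norminf x \<ge> 2 \<longrightarrow>
                 measure (network J \<epsilon>)
                   {\<omega> \<in> space (network J \<epsilon>). ennreal (c * ln (norminf x)) \<le> eff_resistance J \<omega> x}
                 \<ge> 1 - C / norminf x powr \<kappa>)"
      by (rule eff_resistance_ge_log)
  qed
qed

end
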